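(* Let $m,n\ge1$ be integers and let $\mathcal{A}$ be a configuration of type $(m,1^n)$ in $\mathbb{C}^2$. Then the dimension of the space of homogeneous quasi-invariant polynomials of degree $2(m+n-1)$ with respect to $\mathcal{A}$ is $m+n-1$, unless $\mathcal{A}$ is equivalent to $\mathcal{A}_{(m,1^n)}$.
   Context: A configuration of type $(m,1^n)$ consists of $n+1$ pairwise non-collinear vectors $\beta_0,\dots,\beta_n\in\mathbb{C}^2$ with multiplicities $m_0=m$, $m_i=1$ for $1\le i\le n$. All vectors are assumed non-isotropic: $(\beta_i,\beta_i)\ne0$ for $(u,v)=u_1v_1+u_2v_2$. One may take $\beta_0=(0,1)$ and $\beta_i=(1,\alpha_i)$, $\alpha_i\in\mathbb{C}$, for $1\le i\le n$. A polynomial $p\in\mathbb{C}[x_1,x_2]$ is quasi-invariant with respect to $\mathcal{A}$ if $\partial_{\beta_i}^{2s-1}p|_{\Pi_i}=0$ for all $i$ and all $1\le s\le m_i$, where $\partial_{\beta_i}=(\beta_i,\frac{\partial}{\partial x})$ and $\Pi_i=\{x:(\beta_i,x)=0\}$. Two configurations are equivalent if one is obtained from the other by an orthogonal transformation of $\mathbb{C}^2$ (preserving $(\cdot,\cdot)$) and multiplication of vectors by non-zero scalars, keeping multiplicities. The configuration $\mathcal{A}_{(m,1^n)}$: vectors $(\cos\varphi_s,\sin\varphi_s)$, $0\le s\le n$, the zeroth being $(1,0)$ with multiplicity $m$ and the others having multiplicity $1$, such that, with $z_s=e^{2i\varphi_s}$, the elementary symmetric polynomials $e_k=e_k(z_1,\dots,z_n)$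 have the values $e_k=(-1)^k\binom{n}{k}\binom{m+k-1}{k}\binom{m+n-1}{k}^{-1}$ for $1\le k\le n$. *)

theory Defs
  imports "HOL-Analysis.Analysis" "HOL-Computational_Algebra.Polynomial"
begin

(* The polynomial ring C[x1,x2] is represented as C[x1][x2]: for p :: complex poly poly,
   coeff (coeff p j) i is the coefficient of x1^i x2^j. *)

definition eval2 :: "complex poly poly \<Rightarrow> complex ^ 2 \<Rightarrow> complex" where
  "eval2 p x = poly (poly p [:x $ 2:]) (x $ 1)"

definition scale2 :: "complex \<Rightarrow> complex poly poly \<Rightarrow> complex poly poly" where
  "scale2 c p = smult [:c:] p"

definition homogeneous2 :: "nat \<Rightarrow> complex poly poly \<Rightarrow> bool" where
  "homogeneous2 d p \<longleftrightarrow> (\<forall>i j. coeff (coeff p j) i \<noteq> 0 \<longrightarrow> i + j = d)"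

definition dir_deriv :: "complex ^ 2 \<Rightarrow> complex poly poly \<Rightarrow> complex poly poly" where
  "dir_deriv b p = scale2 (b $ 1) (map_poly pderiv p) + scale2 (b $ 2) (pderiv p)"

(* The form (u,v) = u1 v1 + u2 v2 is the bilinear (not Hermitian) scalar_product of the library.
   A configuration is a family of vectors indexed by {..n}; its multiplicities are given
   separately. Two non-isotropic, hence non-zero, vectors are non-collinear over C iff neither
   is a complex multiple of the other. *)

definition configuration :: "nat \<Rightarrow> (nat \<Rightarrow> complex ^ 2) \<Rightarrow> bool" where
  "configuration n \<beta> \<longleftrightarrow>
     (\<forall>i\<le>n. scalar_product (\<beta> i) (\<beta> i) \<noteq> 0) \<and>
     (\<forall>i\<le>n. \<forall>j\<le>n. i \<noteq> j \<longrightarrow> (\<forall>c. \<beta> j \<noteq> c *s \<beta> i))"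

definition mult_m1 :: "nat \<Rightarrow> nat \<Rightarrow> nat" where
  "mult_m1 m i = (if i = 0 then m else 1)"

definition quasi_invariant ::
    "nat \<Rightarrow> (nat \<Rightarrow> complex ^ 2) \<Rightarrow> (nat \<Rightarrow> nat) \<Rightarrow> complex poly poly \<Rightarrow> bool" where
  "quasi_invariant n \<beta> \<mu> p \<longleftrightarrow>
     (\<forall>i\<le>n. \<forall>s\<in>{1..\<mu> i}. \<forall>x. scalar_product (\<beta> i) x = 0 \<longrightarrow>
        eval2 ((dir_deriv (\<beta> i) ^^ (2 * s - 1)) p) x = 0)"

definition hom_quasi_invariants ::
    "nat \<Rightarrow> (nat \<Rightarrow> complex ^ 2) \<Rightarrow> (nat \<Rightarrow> nat) \<Rightarrow> nat \<Rightarrow> complex poly poly set" where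
  "hom_quasi_invariants n \<beta> \<mu> d = {p. homogeneous2 d p \<and> quasi_invariant n \<beta> \<mu> p}"

(* A configuration is an unordered collection of vectors with multiplicities, so the vectors may
   be permuted as long as multiplicities are kept; for m = 1 the zeroth one is not distinguished. *)

definition config_equiv ::
    "nat \<Rightarrow> (nat \<Rightarrow> complex ^ 2) \<Rightarrow> (nat \<Rightarrow> nat) \<Rightarrow> (nat \<Rightarrow> complex ^ 2) \<Rightarrow> (nat \<Rightarrow> nat) \<Rightarrow> bool" where
  "config_equiv n \<beta> \<mu> \<gamma> \<nu> \<longleftrightarrow>
     (\<exists>T \<sigma> c. Vector_Spaces.linear (*s) (*s) T \<and>
        (\<forall>u v. scalar_product (T u) (T v) = scalar_product u v) \<and>
        bij_betw \<sigma> {..n} {..n} \<and>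
        (\<forall>i\<le>n. c i \<noteq> 0 \<and> \<gamma> (\<sigma> i) = c i *s T (\<beta> i) \<and> \<nu> (\<sigma> i) = \<mu> i))"

definition elem_sym :: "nat \<Rightarrow> nat \<Rightarrow> (nat \<Rightarrow> complex) \<Rightarrow> complex" where
  "elem_sym k n z = (\<Sum>S | S \<subseteq> {1..n} \<and> card S = k. \<Prod>s\<in>S. z s)"

(* The defining conditions of the configuration A_(m,1^n) determine its vectors only up to order
   and sign, so it is rendered as a predicate on families of vectors. The angles are complex. *)

definition is_A_m1 :: "nat \<Rightarrow> nat \<Rightarrow> (nat \<Rightarrow> complex ^ 2) \<Rightarrow> bool" where
  "is_A_m1 m n \<gamma> \<longleftrightarrow>
     (\<exists>\<phi> :: nat \<Rightarrow> complex.
        (\<forall>s\<le>n. \<gamma> s = vector [cos (\<phi> s), sin (\<phi> s)]) \<and>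
        \<gamma> 0 = vector [1, 0] \<and>
        (\<forall>k\<in>{1..n}. elem_sym k n (\<lambda>s. exp (2 * \<i> * \<phi> s)) =
           (-1) ^ k * of_nat (n choose k) * of_nat ((m + k - 1) choose k)
             / of_nat ((m + n - 1) choose k)))"

lemma vector_space_scale2: "vector_space scale2"
  by unfold_locales (simp_all add: scale2_def smult_add_right smult_add_left[symmetric] mult.commute one_pCons[symmetric])

lemma dir_deriv_add: "dir_deriv b (p + q) = dir_deriv b p + dir_deriv b q"
proof -
  have "map_poly pderiv (p + q) = map_poly pderiv p + map_poly pderiv q"
    by (rule poly_eqI) (simp add: coeff_map_poly pderiv_add)
  then show ?thesis by (simp add: dir_deriv_def scale2_def smult_add_right pderiv_add)
qed

lemma dir_deriv_scale2: "dir_deriv b (scale2 c p) = scale2 c (dir_deriv b p)"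
proof -
  have "map_poly pderiv (smult [:c:] p) = smult [:c:] (map_poly pderiv p)"
    by (rule poly_eqI) (simp add: coeff_map_poly pderiv_smult)
  then show ?thesis
    by (simp add: dir_deriv_def scale2_def smult_add_right pderiv_smult mult.commute)
qed

lemma dir_deriv_zero: "dir_deriv b 0 = 0"
  by (simp add: dir_deriv_def scale2_def)

lemma subspace_hom_quasi_invariants:
  "module.subspace scale2 (hom_quasi_invariants n \<beta> \<mu> d)"
proof -
  interpret vector_space scale2 by (rule vector_space_scale2)
  have add: "(dir_deriv b ^^ k) (p + q) = (dir_deriv b ^^ k) p + (dir_deriv b ^^ k) q" for b k p q
    by (induction k) (simp_all add: dir_deriv_add)
  have scale: "(dir_deriv b ^^ k) (scale2 c p) = scale2 c ((dir_deriv b ^^ k) p)" for b k c p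
    by (induction k) (simp_all add: dir_deriv_scale2)
  have zero: "(dir_deriv b ^^ k) 0 = 0" for b k
    by (induction k) (simp_all add: dir_deriv_zero)
  have ev: "eval2 0 x = 0" "eval2 (p + q) x = eval2 p x + eval2 q x"
    "eval2 (scale2 c p) x = c * eval2 p x" for p q c x
    by (simp_all add: eval2_def scale2_def)
  have hom: "homogeneous2 d 0" "homogeneous2 d p \<Longrightarrow> homogeneous2 d q \<Longrightarrow> homogeneous2 d (p + q)"
    "homogeneous2 d p \<Longrightarrow> homogeneous2 d (scale2 c p)" for p q c
    unfolding homogeneous2_def scale2_def
    by (simp, metis add_0 coeff_add, simp)
  show ?thesis
    unfolding hom_quasi_invariants_def
    by (rule subspaceI) (simp_all add: hom quasi_invariant_def add scale zero ev)
qed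

end

(*
  In the isotropic coordinates z = x1 + i x2, w = x1 - i x2 the quasi-invariance conditions of a
  homogeneous polynomial of degree 2M, M = m + n - 1, are m + n linear functionals on a space of
  dimension 2M + 1, so the claim is that they are linearly independent. Up to a common nonzero
  factor, the functional of beta_i (i > 0) takes the value (a - M) z_i^a on z^a w^(2M-a), and those
  of beta_0 take the values (a - M) E(a - M), where E runs through independent polynomials of
  degree at most 2m - 2. A linear relation therefore gives an exponential polynomial
  g(a) = sum_i c_i z_i^a + E(a - M) vanishing for all 0 <= a <= 2M except possibly a = M.
  It is annihilated by the recurrence with characteristic polynomial R = (t-1)^(2m-1) P, where
  P = prod_i (t - z_i). If g(M) = 0, then g = 0 and the relation is trivial; otherwise shifting the
  recurrence shows that R has no terms in the degrees m, ..., m+n-1. The hypergeometric operator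
  with parameters 1 - m, 1 - 2m - n; 1 - m - n maps polynomials with this gap to polynomials with at
  most 2m - 2 terms. The image of R is still divisible by (t-1)^(2m-1), hence 0. Written for P, this
  is a two-term recurrence for the coefficients, which yields the e_k of A_(m,1^n).
*)
theory Submission
  imports Defs
begin

section \<open>Sparse polynomials and the hypergeometric operator\<close>

text \<open>A zero of high order at 1 forces many terms. Dividing by the lowest power of the
  variable leaves the order at 1 unchanged; differentiating then removes one term and one order of
  vanishing.\<close>

lemma sparse_poly_eq_0:
  fixes p :: "'a :: field_char_0 poly"
  assumes "card {k. coeff p k \<noteq> 0} \<le> N" "[:-1, 1:] ^ N dvd p"
  shows "p = 0"
  using assms
proof (induction N arbitrary: p)
  case 0
  have "finite {k. coeff p k \<noteq> 0}"
    by (rule finite_subset[of _ "{..degree p}"]) (auto intro: le_degree)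
  then show ?case using 0 by (auto intro: poly_eqI)
next
  case (Suc N)
  show ?case
  proof (rule ccontr)
    assume "p \<noteq> 0"
    define a where "a = (LEAST k. coeff p k \<noteq> 0)"
    have a: "coeff p a \<noteq> 0" unfolding a_def
      by (rule LeastI_ex) (use \<open>p \<noteq> 0\<close> in \<open>auto simp: poly_eq_iff\<close>)
    have below: "coeff p k = 0" if "k < a" for k using that not_less_Least unfolding a_def by blast
    define q where "q = poly_shift a p"
    have q: "coeff q k = coeff p (k + a)" for k by (simp add: q_def coeff_poly_shift)
    have p: "p = monom 1 a * q"
      by (rule poly_eqI) (auto simp: coeff_monom_mult q below)
    have "order 1 (monom 1 a :: 'a poly) = 0" by (rule order_0I) (simp add: poly_monom)
    moreover have "Suc N \<le> order 1 p" using Suc.prems(2) \<open>p \<noteq> 0\<close> order_divides[of 1 "Suc N" p] by blast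
    ultimately have "Suc N \<le> order 1 q" using \<open>p \<noteq> 0\<close> by (simp add: p order_mult)
    then have dvd: "[:-1, 1:] ^ Suc N dvd q" using order_divides[of 1 "Suc N" q] by blast
    then obtain r where r: "q = [:-1, 1:] ^ Suc N * r" by blast
    have "pderiv q = [:-1, 1:] ^ N * (smult (of_nat (Suc N)) r + [:-1, 1:] * pderiv r)"
      unfolding r pderiv_mult pderiv_power_Suc by (simp add: pderiv_pCons algebra_simps)
    then have 1: "[:-1, 1:] ^ N dvd pderiv q" by simp
    have fin: "finite {k. coeff p k \<noteq> 0}"
      by (rule finite_subset[of _ "{..degree p}"]) (auto intro: le_degree)
    \<comment> \<open>The exponents of \<open>pderiv q\<close>, shifted by \<open>Suc a\<close>, are
      exponents of \<open>p\<close> other than the lowest one.\<close>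
    have "card ((\<lambda>k. k + Suc a) ` {k. coeff (pderiv q) k \<noteq> 0}) \<le> card ({k. coeff p k \<noteq> 0} - {a})"
      by (rule card_mono) (use fin in \<open>auto simp: coeff_pderiv q\<close>)
    then have 2: "card {k. coeff (pderiv q) k \<noteq> 0} \<le> N"
      using Suc.prems(1) a fin by (subst (asm) card_image) (auto simp: inj_on_def)
    have "pderiv q = 0" using Suc.IH[OF 2 1] .
    then obtain c where c: "q = [:c:]" using degree_eq_zeroE pderiv_eq_0_iff by blast
    have "poly q 1 = 0" using r by simp
    then have "q = 0" using c by simp
    then show False using p \<open>p \<noteq> 0\<close> by simp
  qed
qed

text \<open>The hypergeometric operators with parameters \<open>a = 1 - m\<close>, \<open>b = 1 - 2m - n\<close> and
  \<open>a = m\<close>, \<open>b = - n\<close>, both with \<open>c = 1 - m - n\<close>, are conjugate by Euler's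
  transformation.\<close>

lemma hypergeometric_conjugate:
  fixes P :: "complex poly" and m n a :: nat
  assumes R: "R = [:-1, 1:] ^ (2 * m - 1) * P" and m: "m \<ge> 1"
  defines "mm \<equiv> of_nat m" and "nn \<equiv> of_nat n"
  shows "[:0, 1, -1:] * pderiv (pderiv R) + [:1 - mm - nn, nn + 3 * mm - 3:] * pderiv R
           - smult ((1 - mm) * (1 - 2 * mm - nn)) R
       = [:-1, 1:] ^ (2 * m - 1) *
           ([:0, 1, -1:] * pderiv (pderiv P) + [:1 - mm - nn, nn - mm - 1:] * pderiv P + smult (mm * nn) P)"
proof -
  \<comment> \<open>One factor \<open>t - 1\<close> is kept apart from \<open>T\<close>. Then each
    derivative of \<open>T\<close> carries enough factors \<open>t - 1\<close> to be reduced to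
    \<open>T\<close> itself, so no division by \<open>x - 1\<close> occurs and \<open>x = 1\<close>
    is covered.\<close>
  obtain a where a: "2 * m - 1 = Suc a" using m by (cases "2 * m - 1") auto
  have "of_nat a + 2 = (of_nat (2 * m) :: complex)" using a m
    by (metis Suc_diff_1 add_2_eq_Suc' mult_pos_pos of_nat_add of_nat_numeral pos2 less_eq_Suc_le One_nat_def)
  then have am: "of_nat a = 2 * mm - 2" by (simp add: mm_def algebra_simps)
  define T :: "complex poly" where "T = [:-1, 1:] ^ a"
  have R': "R = [:-1, 1:] * T * P" by (simp only: R a T_def power_Suc)
  have "[:-1, 1:] * pderiv T = smult (of_nat a) T"
    by (cases a) (simp_all add: T_def pderiv_power_Suc pderiv_pCons del: power_Suc, simp)
  then have "poly ([:-1, 1:] * pderiv T) x = poly (smult (of_nat a) T) x" for x by simp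
  then have T1: "(x - 1) * poly (pderiv T) x = (2 * mm - 2) * poly T x" for x by (simp add: am algebra_simps)
  have "[:-1, 1:] * pderiv (pderiv T) + pderiv T = pderiv ([:-1, 1:] * pderiv T)"
    unfolding pderiv_mult by (simp add: pderiv_pCons)
  also have "\<dots> = smult (of_nat a) (pderiv T)"
    using \<open>[:-1, 1:] * pderiv T = smult (of_nat a) T\<close> by (simp add: pderiv_smult)
  finally have "poly ([:-1, 1:] * pderiv (pderiv T) + pderiv T) x = poly (smult (of_nat a) (pderiv T)) x" for x
    by simp
  then have T2: "(x - 1) * poly (pderiv (pderiv T)) x = (2 * mm - 3) * poly (pderiv T) x" for x
    by (simp add: am algebra_simps)
  show ?thesis
  proof (rule iffD1[OF poly_eq_poly_eq_iff], rule ext)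
    fix x
    define T0 where "T0 = poly T x"
    define U where "U = poly (pderiv T) x"
    define V where "V = poly (pderiv (pderiv T)) x"
    define p0 where "p0 = poly P x"
    define p1 where "p1 = poly (pderiv P) x"
    define p2 where "p2 = poly (pderiv (pderiv P)) x"
    have U: "(x - 1) * U = (2 * mm - 2) * T0" using T1 by (simp add: U_def T0_def)
    have V: "(x - 1) * V = (2 * mm - 3) * U" using T2 by (simp add: U_def V_def)
    show "poly ([:0, 1, -1:] * pderiv (pderiv R) + [:1 - mm - nn, nn + 3 * mm - 3:] * pderiv R
           - smult ((1 - mm) * (1 - 2 * mm - nn)) R) x
       = poly ([:-1, 1:] ^ (2 * m - 1) *
           ([:0, 1, -1:] * pderiv (pderiv P) + [:1 - mm - nn, nn - mm - 1:] * pderiv P + smult (mm * nn) P)) x"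
      unfolding a power_Suc T_def[symmetric] R' pderiv_mult pderiv_add
      apply (simp add: pderiv_pCons pderiv_mult pderiv_add flip: T0_def U_def V_def p0_def p1_def p2_def)
      using U V by algebra
  qed
qed

text \<open>The product \<open>R\<close> lives on two blocks of exponents, \<open>0..m-1\<close> and
  \<open>m+n..2m+n-1\<close>. The zeros of the factors in \<open>cLR\<close> cut off the top
  exponent of each block and keep the upper block from leaking into the gap. So \<open>LR\<close> is
  too sparse for its zero at 1, and its cofactor \<open>LP\<close> vanishes; the recurrence is
  \<open>LP = 0\<close> read off coefficientwise.\<close>

lemma hypergeometric_recurrence:
  fixes P :: "complex poly" and m n :: nat
  assumes m: "m \<ge> 1"
    and gap: "\<And>j. m \<le> j \<Longrightarrow> j \<le> m + n - 1 \<Longrightarrow> coeff ([:-1, 1:] ^ (2 * m - 1) * P) j = 0"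
    and deg: "degree P \<le> n" and n: "n \<ge> 1"
  shows "of_nat (k + 1) * (of_nat (m + n) - of_nat (k + 1)) * coeff P (k + 1)
       = of_nat (m + k) * (of_nat n - of_nat k) * coeff P k"
proof -
  define R where "R = [:-1, 1:] ^ (2 * m - 1) * P"
  define mm nn :: complex where "mm = of_nat m" and "nn = of_nat n"
  define LR where "LR = [:0, 1, -1:] * pderiv (pderiv R) + [:1 - mm - nn, nn + 3 * mm - 3:] * pderiv R
           - smult ((1 - mm) * (1 - 2 * mm - nn)) R"
  define LP where "LP = [:0, 1, -1:] * pderiv (pderiv P) + [:1 - mm - nn, nn - mm - 1:] * pderiv P + smult (mm * nn) P"
  have LR: "LR = [:-1, 1:] ^ (2 * m - 1) * LP"
    unfolding LR_def LP_def mm_def nn_def by (rule hypergeometric_conjugate[OF R_def m])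
  have cLR: "coeff LR k = of_nat (k + 1) * (of_nat (k + 1) - mm - nn) * coeff R (k + 1)
      - (of_nat (k + 1) - mm) * (of_nat (k + 1) - 2 * mm - nn) * coeff R k" for k
    unfolding LR_def
    by (cases k; cases "k - 1") (auto simp: coeff_pderiv algebra_simps)
  have cLP: "coeff LP k = of_nat (k + 1) * (of_nat (k + 1) - mm - nn) * coeff P (k + 1)
      + (mm + of_nat k) * (nn - of_nat k) * coeff P k" for k
    unfolding LP_def
    by (cases k; cases "k - 1") (auto simp: coeff_pderiv algebra_simps)
  have "degree R \<le> 2 * m - 1 + n"
    unfolding R_def using deg
    by (intro order.trans[OF degree_mult_le]) (simp add: degree_linear_power)
  then have R0: "coeff R j = 0" if "j \<ge> 2 * m + n \<or> (m \<le> j \<and> j \<le> m + n - 1)" for j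
    using that
  proof (elim disjE)
    assume "j \<ge> 2 * m + n"
    then have "degree R < j" using \<open>degree R \<le> 2 * m - 1 + n\<close> m by linarith
    then show ?thesis by (rule coeff_eq_0)
  next
    assume "m \<le> j \<and> j \<le> m + n - 1"
    then show ?thesis using gap unfolding R_def by blast
  qed
  have "{k. coeff LR k \<noteq> 0} \<subseteq> {..<m - 1} \<union> {m + n..<2 * m + n - 1}"
  proof
    fix k assume "k \<in> {k. coeff LR k \<noteq> 0}"
    then have k: "coeff LR k \<noteq> 0" by simp
    show "k \<in> {..<m - 1} \<union> {m + n..<2 * m + n - 1}"
    proof (rule ccontr)
      assume "\<not> ?thesis"
      \<comment> \<open>In cases 1, 3 and 4 one coefficient of \<open>R\<close> is zero and the
        other one meets a vanishing factor of \<open>cLR\<close>; in cases 2 and 5 both coefficients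
        of \<open>R\<close> are zero.\<close>
      then consider "k + 1 = m" | "m \<le> k" "k + 1 < m + n" | "k + 1 = m + n" | "k + 1 = 2 * m + n" | "k \<ge> 2 * m + n"
        using m n by fastforce
      then have "coeff LR k = 0"
      proof cases
        case 1
        then have "of_nat (k + 1) = mm" by (simp add: mm_def)
        moreover have "coeff R (k + 1) = 0" using 1 n by (intro R0) auto
        ultimately show ?thesis by (simp only: cLR) simp
      next
        case 2
        then show ?thesis by (simp add: cLR R0)
      next
        case 3
        then have "of_nat (k + 1) = mm + nn" by (simp add: mm_def nn_def flip: of_nat_add)
        moreover have "coeff R k = 0" using 3 n by (intro R0) auto
        ultimately show ?thesis by (simp only: cLR) simp
      next
        case 4
        then have "of_nat (k + 1) = 2 * mm + nn" by (simp add: mm_def nn_def)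
        moreover have "coeff R (k + 1) = 0" using 4 n by (intro R0) auto
        ultimately show ?thesis by (simp only: cLR) simp
      next
        case 5
        then show ?thesis by (simp add: cLR R0)
      qed
      with k show False by simp
    qed
  qed
  then have "card {k. coeff LR k \<noteq> 0} \<le> card ({..<m - 1} \<union> {m + n..<2 * m + n - 1})"
    by (intro card_mono) auto
  also have "\<dots> \<le> (m - 1) + (m - 1)"
    by (rule order.trans[OF card_Un_le]) simp
  finally have "card {k. coeff LR k \<noteq> 0} \<le> 2 * m - 1" using m by simp
  then have "LR = 0" by (rule sparse_poly_eq_0) (simp add: LR)
  then have "LP = 0" by (simp add: LR)
  then show ?thesis using cLP[of k] by (simp add: mm_def nn_def algebra_simps)
qed

section \<open>Exponential polynomials and elementary symmetric polynomials\<close>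

lemma poly_eq_sum_atMost:
  fixes p :: "'a :: comm_semiring_1 poly"
  assumes "degree p \<le> D"
  shows "poly p x = (\<Sum>i\<le>D. coeff p i * x ^ i)"
  unfolding poly_altdef
  by (rule sum.mono_neutral_left) (use assms in \<open>auto simp: coeff_eq_0\<close>)

text \<open>Read as a polynomial in the shift operator, \<open>S\<close> contains the
  \<open>N\<close>-th power of the difference operator, which kills polynomial sequences of degree
  below \<open>N\<close>.\<close>

lemma sum_coeff_poly_eq_0:
  fixes E S :: "complex poly"
  assumes "[:-1, 1:] ^ N dvd S" "degree E < N" "degree S \<le> D"
  shows "(\<Sum>j\<le>D. coeff S j * poly E (of_nat j + x)) = 0"
  using assms
proof (induction E arbitrary: N S)
  case 0
  then show ?case by simp
next
  case (pCons a E)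
  obtain M where N: "N = Suc M" using pCons.prems(2) by (cases N) auto
  \<comment> \<open>This is \<open>t S'(t) + x S(t)\<close> with the derivative of \<open>S\<close>:
    it absorbs the factor \<open>of_nat j + x\<close> split off from \<open>pCons a E\<close>, at
    the cost of one factor \<open>t - 1\<close>.\<close>
  define S' where "S' = pCons 0 (pderiv S) + smult x S"
  have S': "coeff S' j = (of_nat j + x) * coeff S j" for j
    by (cases j) (simp_all add: S'_def coeff_pderiv algebra_simps)
  obtain U where U: "S = [:-1, 1:] ^ Suc M * U" using pCons.prems(1) N by auto
  have "S' = [:-1, 1:] ^ M * (pCons 0 (smult (of_nat (Suc M)) U + [:-1, 1:] * pderiv U) + smult x ([:-1, 1:] * U))"
    unfolding S'_def U pderiv_mult pderiv_power_Suc by (simp add: pderiv_pCons algebra_simps)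
  then have dvd: "[:-1, 1:] ^ M dvd S'" by simp
  have deg: "degree S' \<le> D"
    by (rule degree_le) (use pCons.prems(3) in \<open>auto simp: S' coeff_eq_0\<close>)
  have "(\<Sum>j\<le>D. coeff S j) = poly S 1"
    using poly_eq_sum_atMost[OF pCons.prems(3), of 1] by simp
  then have S1: "(\<Sum>j\<le>D. coeff S j) = 0" by (simp add: U)
  have IH: "(\<Sum>j\<le>D. coeff S' j * poly E (of_nat j + x)) = 0"
  \<comment> \<open>For \<open>E = 0\<close> the strict degree bound of the induction hypothesis can
    fail, since \<open>M\<close> may be 0.\<close>
  proof (cases "E = 0")
    case False
    then have "degree E < M" using pCons.prems(2) N by simp
    then show ?thesis using pCons.IH[OF dvd _ deg] by simp
  qed simp
  have "(\<Sum>j\<le>D. coeff S j * poly (pCons a E) (of_nat j + x))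
      = a * (\<Sum>j\<le>D. coeff S j) + (\<Sum>j\<le>D. coeff S' j * poly E (of_nat j + x))"
    by (simp add: S' sum_distrib_left flip: sum.distrib) (simp add: algebra_simps)
  then show ?case by (simp add: S1 IH)
qed

section \<open>From the gap to the elementary symmetric polynomials\<close>

definition lin_prod :: "nat \<Rightarrow> (nat \<Rightarrow> complex) \<Rightarrow> complex poly" where
  "lin_prod n z = (\<Prod>i\<in>{1..n}. [:- z i, 1:])"

lemma degree_lin_prod: "degree (lin_prod n z) = n"
  unfolding lin_prod_def by (subst degree_prod_eq_sum_degree) auto

text \<open>Vieta's formula: the product is expanded over the set \<open>S\<close> of factors that
  contribute their constant term.\<close>

lemma coeff_lin_prod:
  assumes "k \<le> n"
  shows "coeff (lin_prod n z) (n - k) = (-1) ^ k * elem_sym k n z"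
proof -
  have "lin_prod n z = (\<Prod>i\<in>{1..n}. [:- z i:] + monom 1 1)"
    unfolding lin_prod_def by (rule prod.cong) (simp_all add: monom_altdef)
  also have "\<dots> = (\<Sum>S\<in>Pow {1..n}. (\<Prod>i\<in>S. [:- z i:]) * (\<Prod>i\<in>{1..n} - S. monom 1 1))"
    by (rule prod_add) simp
  also have "\<dots> = (\<Sum>S\<in>Pow {1..n}. monom ((-1) ^ card S * (\<Prod>i\<in>S. z i)) (n - card S))"
  proof (rule sum.cong[OF refl])
    fix S assume S: "S \<in> Pow {1..n}"
    then have fin: "finite S" using finite_subset by auto
    have "(\<Prod>i\<in>S. [:- z i:]) = [: (-1) ^ card S * (\<Prod>i\<in>S. z i) :]"
      using fin by (induction S rule: finite_induct) (auto simp: one_pCons)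
    moreover have "card ({1..n} - S) = n - card S" using S by (simp add: card_Diff_subset fin)
    ultimately show "(\<Prod>i\<in>S. [:- z i:]) * (\<Prod>i\<in>{1..n} - S. monom 1 1)
       = monom ((-1) ^ card S * (\<Prod>i\<in>S. z i)) (n - card S)"
      by (simp add: monom_power smult_monom)
  qed
  finally have "coeff (lin_prod n z) (n - k)
     = (\<Sum>S\<in>Pow {1..n}. if n - card S = n - k then (-1) ^ card S * (\<Prod>i\<in>S. z i) else 0)"
    by (simp add: coeff_sum)
  also have "\<dots> = (\<Sum>S\<in>Pow {1..n}. if card S = k then (-1) ^ k * (\<Prod>i\<in>S. z i) else 0)"
  proof (rule sum.cong[OF refl])
    fix S assume "S \<in> Pow {1..n}"
    \<comment> \<open>Since \<open>card S\<close> and \<open>k\<close> are both at most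
      \<open>n\<close>, truncated subtraction from \<open>n\<close> does not identify them when they
      differ.\<close>
    then have "card S \<le> n" using card_mono[of "{1..n}" S] by auto
    then show "(if n - card S = n - k then (-1) ^ card S * (\<Prod>i\<in>S. z i) else 0) =
      (if card S = k then (-1) ^ k * (\<Prod>i\<in>S. z i) else 0)" using assms by auto
  qed
  also have "\<dots> = (\<Sum>S | S \<subseteq> {1..n} \<and> card S = k. (-1) ^ k * (\<Prod>i\<in>S. z i))"
    by (subst sum.inter_filter[symmetric]) (auto intro!: sum.cong)
  finally show ?thesis by (simp add: elem_sym_def sum_distrib_left)
qed

text \<open>The three binomials have successive ratios \<open>(n-k)/(k+1)\<close>,
  \<open>(m+k)/(k+1)\<close> and \<open>(m+n-1-k)/(k+1)\<close>; together these give the ratio that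
  the recurrence prescribes.\<close>

lemma ratio_recurrence_solution:
  fixes p :: "nat \<Rightarrow> complex"
  assumes m: "m \<ge> 1" and p0: "p 0 = 1" and k: "k \<le> n"
    and rec: "\<And>j. j < n \<Longrightarrow> of_nat (j + 1) * of_nat (m + n - 1 - j) * p (j + 1) = of_nat (n - j) * of_nat (m + j) * p j"
  shows "p k = of_nat (n choose k) * of_nat ((m + k - 1) choose k) / of_nat ((m + n - 1) choose k)"
  using k
proof (induction k)
  case 0
  then show ?case by (simp add: p0)
next
  case (Suc k)
  have c1: "of_nat (Suc k) * of_nat (n choose Suc k) = (of_nat (n - k) * of_nat (n choose k) :: complex)" for n
    by (metis binomial_absorb_comp binomial_absorption of_nat_mult mult.commute times_binomial_minus1_eq)
  have c2: "of_nat (Suc k) * of_nat ((m + k) choose Suc k) = (of_nat (m + k) * of_nat ((m + k - 1) choose k) :: complex)"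
    by (metis add_diff_cancel_left' diff_Suc_1 of_nat_mult times_binomial_minus1_eq zero_less_Suc)
  define s a b c :: complex where "s = of_nat (Suc k)" and "a = of_nat (n - k)" and "b = of_nat (m + k)" and "c = of_nat (m + n - 1 - k)"
  \<comment> \<open>As \<open>k < n\<close>, the number \<open>m+n-1-k\<close> is at least
    \<open>m\<close>, hence positive.\<close>
  have nz: "s \<noteq> 0" "c \<noteq> 0" "(of_nat ((m + n - 1) choose k) :: complex) \<noteq> 0"
    "(of_nat ((m + n - 1) choose Suc k) :: complex) \<noteq> 0"
    using Suc.prems m unfolding s_def c_def of_nat_eq_0_iff by auto
  have e: "of_nat (n choose Suc k) = a * of_nat (n choose k) / s"
    "of_nat ((m + k) choose Suc k) = b * of_nat ((m + k - 1) choose k) / s"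
    "of_nat ((m + n - 1) choose Suc k) = c * of_nat ((m + n - 1) choose k) / s"
    using c1[of n] c2 c1[of "m + n - 1"] nz(1)
    unfolding s_def[symmetric] a_def[symmetric] b_def[symmetric] c_def[symmetric]
    by (simp_all add: field_simps)
  have "s * c * p (Suc k) = a * b * p k"
    using rec[of k] Suc.prems unfolding s_def a_def b_def c_def Suc_eq_plus1 by linarith
  then have "p (Suc k) = a * b * p k / (s * c)" using nz(1,2) by (simp add: field_simps)
  also have "\<dots> = of_nat (n choose Suc k) * of_nat ((m + k) choose Suc k) / of_nat ((m + n - 1) choose Suc k)"
    unfolding e using Suc.IH Suc.prems nz by (simp add: field_simps)
  finally show ?case by simp
qed

lemma elem_sym_of_gap:
  assumes m: "m \<ge> 1" and n: "n \<ge> 1" and k: "k \<le> n"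
    and gap: "\<And>j. m \<le> j \<Longrightarrow> j \<le> m + n - 1 \<Longrightarrow> coeff ([:-1, 1:] ^ (2 * m - 1) * lin_prod n z) j = 0"
  shows "elem_sym k n z = (-1) ^ k * of_nat (n choose k) * of_nat ((m + k - 1) choose k)
             / of_nat ((m + n - 1) choose k)"
proof -
  \<comment> \<open>Coefficients are counted from the top, where monicity supplies the starting
    value and \<open>p j\<close> is the \<open>j\<close>-th elementary symmetric polynomial up to
    sign.\<close>
  define p where "p = (\<lambda>j. coeff (lin_prod n z) (n - j))"
  have "{S. S \<subseteq> {1..n} \<and> card S = 0} = {{}}"
    using finite_subset[of _ "{1..n}"] by auto
  then have "elem_sym 0 n z = 1" by (simp add: elem_sym_def)
  then have "p 0 = 1" using coeff_lin_prod[of 0 n z] by (simp add: p_def)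
  moreover have "of_nat (j + 1) * of_nat (m + n - 1 - j) * p (j + 1) = of_nat (n - j) * of_nat (m + j) * p j" if "j < n" for j
  proof -
    \<comment> \<open>The recurrence at this index links the coefficients at \<open>n - j\<close>
      and \<open>n - j - 1\<close>, that is, \<open>p j\<close> and
      \<open>p (j + 1)\<close>.\<close>
    define i where "i = n - j - 1"
    have i: "n - j = i + 1" "n - Suc j = i" using that by (auto simp: i_def)
    have "of_nat n = of_nat j + of_nat i + (1 :: complex)" using that by (simp add: i_def of_nat_diff)
    moreover have "m + n - 1 - j = m + i" using that m by (simp add: i_def)
    ultimately show ?thesis
      using hypergeometric_recurrence[OF m gap _ n, of i] that
      by (simp add: p_def i degree_lin_prod algebra_simps)
  qed
  ultimately have "p k = of_nat (n choose k) * of_nat ((m + k - 1) choose k) / of_nat ((m + n - 1) choose k)"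
    by (intro ratio_recurrence_solution m k) auto
  moreover have "elem_sym k n z = (-1) ^ k * p k"
    using coeff_lin_prod[OF k, of z] by (simp add: p_def flip: power_mult_distrib)
  ultimately show ?thesis by simp
qed

text \<open>In the shift operator, \<open>S\<close> multiplies the sequence of powers of
  \<open>z i\<close> by the value of \<open>S\<close> at \<open>z i\<close> and kills the polynomial
  part; the sum is the result at 0.\<close>

lemma sum_coeff_exponential_poly:
  fixes S E :: "complex poly" and c z :: "nat \<Rightarrow> complex"
  assumes deg: "degree S \<le> D" and dvd: "[:-1, 1:] ^ N dvd S" and E: "degree E < N"
  shows "(\<Sum>a\<le>D. coeff S a * ((\<Sum>i\<in>{1..n}. c i * z i ^ a) + poly E (of_nat a + x)))
       = (\<Sum>i\<in>{1..n}. c i * poly S (z i))"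
proof -
  have "(\<Sum>a\<le>D. coeff S a * ((\<Sum>i\<in>{1..n}. c i * z i ^ a) + poly E (of_nat a + x)))
     = (\<Sum>a\<le>D. \<Sum>i\<in>{1..n}. c i * (coeff S a * z i ^ a)) + (\<Sum>a\<le>D. coeff S a * poly E (of_nat a + x))"
    by (simp add: sum.distrib algebra_simps sum_distrib_left)
  also have "(\<Sum>a\<le>D. coeff S a * poly E (of_nat a + x)) = 0"
    by (rule sum_coeff_poly_eq_0[OF dvd E deg])
  also have "(\<Sum>a\<le>D. \<Sum>i\<in>{1..n}. c i * (coeff S a * z i ^ a)) = (\<Sum>i\<in>{1..n}. c i * poly S (z i))"
    by (subst sum.swap) (simp add: poly_eq_sum_atMost[OF deg] sum_distrib_left)
  finally show ?thesis by simp
qed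

text \<open>On the window \<open>0..2M\<close> the sequence \<open>g\<close> is zero off the centre
  \<open>M\<close>, so pairing it with the coefficients of suitable polynomials gives information
  about coefficient \<open>M\<close> alone.\<close>

lemma elem_sym_of_dependence:
  fixes c z :: "nat \<Rightarrow> complex" and E :: "complex poly"
  assumes m: "m \<ge> 1" and n: "n \<ge> 1" and k: "k \<le> n"
    and inj: "inj_on z {1..n}" and z1: "\<And>i. i \<in> {1..n} \<Longrightarrow> z i \<noteq> 1"
    and E: "degree E \<le> 2 * m - 2"
    and nontriv: "(\<exists>i\<in>{1..n}. c i \<noteq> 0) \<or> E \<noteq> 0"
    and zero: "\<And>a. a \<le> 2 * (m + n - 1) \<Longrightarrow> a \<noteq> m + n - 1 \<Longrightarrow>
      (\<Sum>i\<in>{1..n}. c i * z i ^ a) + poly E (of_nat a - of_nat (m + n - 1)) = 0"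
  shows "elem_sym k n z = (-1) ^ k * of_nat (n choose k) * of_nat ((m + k - 1) choose k)
             / of_nat ((m + n - 1) choose k)"
proof (rule elem_sym_of_gap[OF m n k])
  define M where "M = m + n - 1"
  define g where "g = (\<lambda>a. (\<Sum>i\<in>{1..n}. c i * z i ^ a) + poly E (of_nat a + (- of_nat M)))"
  have g0: "g a = 0" if "a \<le> 2 * M" "a \<noteq> M" for a
    using zero[of a, folded M_def] that by (simp add: g_def)
  have E': "degree E < 2 * m - 1" using E m by linarith
  have key: "(\<Sum>a\<le>2 * M. coeff S a * g a) = (\<Sum>i\<in>{1..n}. c i * poly S (z i))"
    if "degree S \<le> 2 * M" "[:-1, 1:] ^ (2 * m - 1) dvd S" for S
    unfolding g_def by (rule sum_coeff_exponential_poly[OF that E'])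
  have "g M \<noteq> 0"
  proof
    assume "g M = 0"
    then have g: "g a = 0" if "a \<le> 2 * M" for a using g0 that by metis
    have c: "c i = 0" if i: "i \<in> {1..n}" for i
    proof -
      \<comment> \<open>The test polynomial \<open>S\<close> vanishes at every \<open>z l\<close>
        except \<open>z i\<close>, so the pairing isolates \<open>c i\<close>.\<close>
      define Q where "Q = (\<Prod>l\<in>{1..n} - {i}. [:- z l, 1:])"
      define S where "S = [:-1, 1:] ^ (2 * m - 1) * Q"
      have "degree Q = n - 1" unfolding Q_def using i by (subst degree_prod_eq_sum_degree) auto
      then have "degree S \<le> 2 * M" unfolding S_def using m n
        by (intro order.trans[OF degree_mult_le]) (simp add: degree_linear_power M_def)
      then have "(\<Sum>l\<in>{1..n}. c l * poly S (z l)) = 0"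
        using key[of S] g by (simp add: S_def)
      moreover have "(\<Sum>l\<in>{1..n}. c l * poly S (z l)) = c i * poly S (z i)"
      proof -
        have "poly S (z l) = 0" if "l \<in> {1..n} - {i}" for l
        proof -
          have "poly Q (z l) = 0" unfolding Q_def poly_prod
            by (rule prod_zero) (use that in auto)
          then show ?thesis by (simp add: S_def)
        qed
        then show ?thesis using i by (subst sum.remove[of _ i]) auto
      qed
      moreover have "poly S (z i) \<noteq> 0"
      proof -
        have "poly Q (z i) \<noteq> 0"
          unfolding Q_def poly_prod using inj i by (subst prod_zero_iff) (auto dest: inj_onD)
        then show ?thesis using z1[OF i] by (simp add: S_def)
      qed
      ultimately show ?thesis by simp
    qed
    \<comment> \<open>Only the polynomial part is left; it has \<open>2M+1\<close> distinct zeros,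
      more than its degree allows.\<close>
    have "poly E (of_nat a + (- of_nat M)) = 0" if "a \<le> 2 * M" for a
      using g[OF that] c by (simp add: g_def)
    then have "(\<lambda>a. of_nat a + (- of_nat M)) ` {..2 * M} \<subseteq> {x. poly E x = 0}" by auto
    moreover have "card ((\<lambda>a. of_nat a + (- of_nat M) :: complex) ` {..2 * M}) = 2 * M + 1"
      by (subst card_image) (auto simp: inj_on_def)
    ultimately have "E \<noteq> 0 \<Longrightarrow> 2 * M + 1 \<le> card {x. poly E x = 0}"
      by (metis card_mono poly_roots_finite)
    moreover have "E \<noteq> 0 \<Longrightarrow> card {x. poly E x = 0} \<le> degree E"
      by (rule card_poly_roots_bound)
    moreover have "degree E < 2 * M + 1" using E' m n by (simp add: M_def)
    ultimately have "E = 0" by linarith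
    then show False using nontriv c by auto
  qed
  fix j assume j: "m \<le> j" "j \<le> m + n - 1"
  define R where "R = [:-1, 1:] ^ (2 * m - 1) * lin_prod n z"
  \<comment> \<open>The shift moves coefficient \<open>j\<close> of \<open>R\<close> to the centre.
    The bounds on \<open>j\<close> are exactly those that make the exponent non-negative and keep
    the degree within \<open>2M\<close>.\<close>
  define S where "S = monom 1 (M - j) * R"
  have "degree R \<le> 2 * m - 1 + n" unfolding R_def
    by (intro order.trans[OF degree_mult_le]) (simp add: degree_linear_power degree_lin_prod)
  then have "degree S \<le> 2 * M" unfolding S_def using j m
    by (intro order.trans[OF degree_mult_le]) (simp add: degree_monom_eq M_def)
  then have "(\<Sum>a\<le>2 * M. coeff S a * g a) = (\<Sum>i\<in>{1..n}. c i * poly S (z i))"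
    by (rule key) (simp add: S_def R_def)
  also have "\<dots> = 0"
    by (rule sum.neutral) (auto simp: S_def R_def lin_prod_def poly_prod)
  also have "(\<Sum>a\<le>2 * M. coeff S a * g a) = coeff S M * g M"
    by (subst sum.remove[of _ M]) (auto simp: g0)
  also have "coeff S M = coeff R j" 
  proof -
    have "M - (M - j) = j" using j by (simp add: M_def)
    then show ?thesis by (simp add: S_def coeff_monom_mult)
  qed
  finally show "coeff ([:-1, 1:] ^ (2 * m - 1) * lin_prod n z) j = 0"
    using \<open>g M \<noteq> 0\<close> by (simp add: R_def)
qed

section \<open>Dimension of a common kernel of functionals\<close>

context vector_space
begin

lemma vanishing_on_common_kernel:
  assumes W: "subspace W" and "finite J"
    and "\<And>j. j \<in> J \<Longrightarrow> Vector_Spaces.linear scale (*) (L j)"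
    and "Vector_Spaces.linear scale (*) F"
    and "\<And>x. x \<in> W \<Longrightarrow> (\<And>j. j \<in> J \<Longrightarrow> L j x = 0) \<Longrightarrow> F x = 0"
  shows "\<exists>c. \<forall>x\<in>W. F x = (\<Sum>j\<in>J. c j * L j x)"
  using assms(2-)
proof (induction J arbitrary: F rule: finite_induct)
  case empty
  then show ?case by auto
next
  case (insert a J)
  have La: "Vector_Spaces.linear scale (*) (L a)" using insert.prems(1) by simp
  have F: "Vector_Spaces.linear scale (*) F" by fact
  interpret La: Vector_Spaces.linear scale "(*)" "L a" by fact
  interpret F: Vector_Spaces.linear scale "(*)" F by fact
  show ?case
  proof (cases "\<forall>x\<in>W. (\<forall>j\<in>J. L j x = 0) \<longrightarrow> L a x = 0")
    case True
    then have "\<exists>c. \<forall>x\<in>W. F x = (\<Sum>j\<in>J. c j * L j x)"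
      by (intro insert.IH F insert.prems) auto
    then obtain c where c: "\<forall>x\<in>W. F x = (\<Sum>j\<in>J. c j * L j x)" by blast
    have "(\<Sum>j\<in>insert a J. (c(a := 0)) j * L j x) = (\<Sum>j\<in>J. c j * L j x)" for x
      using insert.hyps by (auto intro: sum.cong)
    then have "\<forall>x\<in>W. F x = (\<Sum>j\<in>insert a J. (c(a := 0)) j * L j x)" using c by simp
    then show ?thesis by blast
  next
    case False
    then obtain u where u: "u \<in> W" "\<And>j. j \<in> J \<Longrightarrow> L j u = 0" "L a u \<noteq> 0" by blast
    define r where "r = F u / L a u"
    define G where "G = (\<lambda>x. F x - r * L a x)"
    have G: "Vector_Spaces.linear scale (*) G"
      unfolding G_def by unfold_locales (simp_all add: F.add La.add F.scale La.scale algebra_simps)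
    have "G x = 0" if x: "x \<in> W" "\<And>j. j \<in> J \<Longrightarrow> L j x = 0" for x
    proof -
      \<comment> \<open>Moving \<open>x\<close> along \<open>u\<close> brings it into the kernel of
        \<open>L a\<close> without changing the other functionals, which vanish at
        \<open>u\<close>.\<close>
      define y where "y = x - scale (L a x / L a u) u"
      have "y \<in> W" unfolding y_def by (intro subspace_diff subspace_scale W x u)
      moreover have "L j y = 0" if "j \<in> insert a J" for j
      proof -
        interpret Lj: Vector_Spaces.linear scale "(*)" "L j" using insert.prems(1) that .
        show ?thesis using that x(2) u(2,3) by (auto simp: y_def Lj.diff Lj.scale)
      qed
      ultimately have "F y = 0" using insert.prems(3) by blast
      then show ?thesis using u(3) by (simp add: y_def F.diff F.scale G_def r_def field_simps)
    qed
    then have "\<exists>c. \<forall>x\<in>W. G x = (\<Sum>j\<in>J. c j * L j x)"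
      by (intro insert.IH G insert.prems(1)) auto
    then obtain c where c: "\<forall>x\<in>W. G x = (\<Sum>j\<in>J. c j * L j x)" by blast
    have "(\<Sum>j\<in>insert a J. (c(a := r)) j * L j x) = r * L a x + (\<Sum>j\<in>J. c j * L j x)" for x
      using insert.hyps by (auto intro: sum.cong)
    then have "\<forall>x\<in>W. F x = (\<Sum>j\<in>insert a J. (c(a := r)) j * L j x)"
      using c by (simp add: G_def algebra_simps)
    then show ?thesis by blast
  qed
qed

text \<open>A basis of the kernel together with \<open>u\<close> is a basis of \<open>U\<close>; the
  finite set \<open>B\<close> makes these bases finite, so that they can be counted.\<close>

lemma dim_kernel_functional:
  assumes U: "subspace U" and fin: "finite B" "U \<subseteq> span B"
    and F: "Vector_Spaces.linear scale (*) F" and u: "u \<in> U" "F u \<noteq> 0"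
  shows "dim U = Suc (dim {x \<in> U. F x = 0})"
proof -
  interpret F: Vector_Spaces.linear scale "(*)" F by fact
  define K where "K = {x \<in> U. F x = 0}"
  obtain C where C: "C \<subseteq> K" "independent C" "K \<subseteq> span C" "card C = dim K"
    using basis_exists[of K] by metis
  have finC: "finite C"
    using independent_span_bound[OF fin(1) C(2)] C(1) fin(2) by (auto simp: K_def)
  have "span C \<subseteq> {x. F x = 0}"
    by (rule span_minimal) (use C(1) in \<open>auto simp: K_def F.subspace_kernel\<close>)
  then have unot: "u \<notin> span C" using u(2) by auto
  have "U \<subseteq> span (insert u C)"
  proof
    fix x assume "x \<in> U"
    then have "x - scale (F x / F u) u \<in> K"
      using u by (auto simp: K_def F.diff F.scale intro!: subspace_diff subspace_scale U)
    then have "x - scale (F x / F u) u \<in> span C" using C(3) by auto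
    then show "x \<in> span (insert u C)" unfolding span_insert by blast
  qed
  moreover have "insert u C \<subseteq> U" using C(1) u(1) by (auto simp: K_def)
  moreover have "independent (insert u C)" by (rule independent_insertI[OF unot C(2)])
  ultimately have "dim U = card (insert u C)" by (metis basis_card_eq_dim)
  also have "\<dots> = Suc (card C)" using finC unot span_base by (subst card_insert_disjoint) auto
  finally show ?thesis using C(4) by (simp add: K_def)
qed

text \<open>By independence on \<open>W\<close>, no functional vanishes on the common kernel of the
  others, so each lowers the dimension by one.\<close>

lemma dim_common_kernel:
  assumes W: "subspace W" and fin: "finite B" "W \<subseteq> span B" and "finite J"
    and "\<And>j. j \<in> J \<Longrightarrow> Vector_Spaces.linear scale (*) (L j)"
    and "\<And>c. (\<And>x. x \<in> W \<Longrightarrow> (\<Sum>j\<in>J. c j * L j x) = 0) \<Longrightarrow> \<forall>j\<in>J. c j = 0"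
  shows "dim W = dim {x \<in> W. \<forall>j\<in>J. L j x = 0} + card J"
  using assms(4-)
proof (induction J rule: finite_induct)
  case empty
  then show ?case by simp
next
  case (insert a J)
  define U where "U = {x \<in> W. \<forall>j\<in>J. L j x = 0}"
  have lin: "Vector_Spaces.linear scale (*) (L j)" if "j \<in> insert a J" for j
    using insert.prems(1) that .
  have U: "subspace U"
  proof -
    have "L j 0 = 0 \<and> L j (x + y) = L j x + L j y \<and> L j (scale r x) = r * L j x"
      if "j \<in> insert a J" for j x y r
    proof -
      interpret Lj: Vector_Spaces.linear scale "(*)" "L j" using lin[OF that] .
      show ?thesis by (simp add: Lj.zero Lj.add Lj.scale)
    qed
    then show ?thesis
      using W by (auto intro!: subspaceI simp: U_def subspace_0 subspace_add subspace_scale)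
  qed
  have "\<forall>j\<in>J. c j = 0" if "\<And>x. x \<in> W \<Longrightarrow> (\<Sum>j\<in>J. c j * L j x) = 0" for c
  proof -
    have "(\<Sum>j\<in>insert a J. (c(a := 0)) j * L j x) = (\<Sum>j\<in>J. c j * L j x)" for x
      using insert.hyps by (auto intro: sum.cong)
    then have "\<forall>j\<in>insert a J. (c(a := 0)) j = 0" using that by (intro insert.prems(2)) simp
    then show ?thesis using insert.hyps(2) by (metis fun_upd_other insertCI)
  qed
  then have IH: "dim W = dim U + card J"
    unfolding U_def by (intro insert.IH lin) simp_all
  have "\<exists>u\<in>U. L a u \<noteq> 0"
  proof (rule ccontr)
    assume "\<not> ?thesis"
    then have "\<exists>c. \<forall>x\<in>W. L a x = (\<Sum>j\<in>J. c j * L j x)"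
      using lin insert.hyps(1) by (intro vanishing_on_common_kernel[OF W]) (auto simp: U_def)
    then obtain c where c: "\<forall>x\<in>W. L a x = (\<Sum>j\<in>J. c j * L j x)" by blast
    \<comment> \<open>The coefficient -1 at \<open>a\<close> turns the expression for
      \<open>L a\<close> into a nontrivial relation.\<close>
    have "(\<Sum>j\<in>insert a J. (c(a := - 1)) j * L j x) = - L a x + (\<Sum>j\<in>J. c j * L j x)" for x
      using insert.hyps by (auto intro: sum.cong)
    then have "\<forall>j\<in>insert a J. (c(a := - 1)) j = 0" using c by (intro insert.prems(2)) simp
    then show False by simp
  qed
  then obtain u where "u \<in> U" "L a u \<noteq> 0" by blast
  then have "dim U = Suc (dim {x \<in> U. L a x = 0})"
    using dim_kernel_functional[OF U fin(1) _ lin] fin(2) by (auto simp: U_def)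
  moreover have "{x \<in> U. L a x = 0} = {x \<in> W. \<forall>j\<in>insert a J. L j x = 0}" by (auto simp: U_def)
  ultimately show ?case using IH insert.hyps by simp
qed

end

section \<open>Directional derivatives in isotropic coordinates\<close>

lemma eval2_pCons: "eval2 (pCons q p) x = poly q (x $ 1) + x $ 2 * eval2 p x"
  by (simp add: eval2_def)

lemma eval2_add: "eval2 (p + q) x = eval2 p x + eval2 q x"
  by (simp add: eval2_def)

lemma eval2_scale2: "eval2 (scale2 c p) x = c * eval2 p x"
  by (simp add: eval2_def scale2_def)

lemma eval2_mult: "eval2 (p * q) x = eval2 p x * eval2 q x"
  by (simp add: eval2_def)

lemma eval2_power: "eval2 (p ^ k) x = eval2 p x ^ k"
  by (simp add: eval2_def)

lemma dir_deriv_pCons: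
  "dir_deriv b (pCons q p) = [:smult (b $ 1) (pderiv q):] + pCons 0 (dir_deriv b p) + scale2 (b $ 2) p"
  by (simp add: dir_deriv_def scale2_def map_poly_pCons pderiv_pCons smult_add_right)

text \<open>The restriction of \<open>p\<close> to the line \<open>v + t b\<close> as a polynomial
  in \<open>t\<close>; derivatives along \<open>b\<close> become derivatives in
  \<open>t\<close>.\<close>

definition line_poly :: "complex poly poly \<Rightarrow> complex ^ 2 \<Rightarrow> complex ^ 2 \<Rightarrow> complex poly" where
  "line_poly p v b = poly (map_poly (\<lambda>q. pcompose q [:v $ 1, b $ 1:]) p) [:v $ 2, b $ 2:]"

lemma line_poly_0: "line_poly 0 v b = 0"
  by (simp add: line_poly_def)

lemma line_poly_pCons:
  "line_poly (pCons q p) v b = pcompose q [:v $ 1, b $ 1:] + [:v $ 2, b $ 2:] * line_poly p v b"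
  by (simp add: line_poly_def map_poly_pCons)

lemma poly_line_poly: "poly (line_poly p v b) t = eval2 p (v + t *s b)"
proof (induction p)
  case 0
  then show ?case by (simp add: line_poly_0 eval2_def)
next
  case (pCons q p)
  then show ?case by (simp add: line_poly_pCons eval2_pCons poly_pcompose algebra_simps)
qed

lemma pderiv_line_poly: "pderiv (line_poly p v b) = line_poly (dir_deriv b p) v b"
proof (induction p)
  case 0
  then show ?case by (simp add: line_poly_0 dir_deriv_zero)
next
  case (pCons q p)
  have "poly (pderiv (line_poly (pCons q p) v b)) t = poly (line_poly (dir_deriv b (pCons q p)) v b) t" for t
  proof -
    have "poly (pderiv (line_poly (pCons q p) v b)) t
        = b $ 1 * poly (pderiv q) (v $ 1 + t * b $ 1) + b $ 2 * eval2 p (v + t *s b)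
          + (v $ 2 + t * b $ 2) * eval2 (dir_deriv b p) (v + t *s b)"
      by (simp add: line_poly_pCons pderiv_add pderiv_mult pderiv_pcompose pderiv_pCons pderiv_smult poly_pcompose
          pCons.IH poly_line_poly algebra_simps)
    also have "\<dots> = eval2 (dir_deriv b (pCons q p)) (v + t *s b)"
      by (simp add: dir_deriv_pCons eval2_add eval2_scale2 eval2_pCons eval2_def[of 0])
    finally show ?thesis by (simp add: poly_line_poly)
  qed
  then show ?case by (simp add: poly_eq_poly_eq_iff[symmetric] fun_eq_iff)
qed

text \<open>Taylor's formula at \<open>t = 0\<close> for the restriction to the line through
  \<open>v\<close> in direction \<open>b\<close>.\<close>

lemma eval2_dir_deriv_power:
  "eval2 ((dir_deriv b ^^ s) p) v = fact s * coeff (line_poly p v b) s"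
proof -
  have "(pderiv ^^ s) (line_poly p v b) = line_poly ((dir_deriv b ^^ s) p) v b"
    by (induction s) (simp_all add: pderiv_line_poly)
  then have "eval2 ((dir_deriv b ^^ s) p) v = poly ((pderiv ^^ s) (line_poly p v b)) 0"
    by (simp add: poly_line_poly)
  also have "\<dots> = fact s * coeff (line_poly p v b) s"
    by (simp add: poly_0_coeff_0 coeff_higher_pderiv pochhammer_fact)
  finally show ?thesis .
qed

text \<open>The monomial \<open>z^a w^(d-a)\<close> in \<open>z = x1 + i x2\<close> and
  \<open>w = x1 - i x2\<close>.\<close>

definition iso_monomial :: "nat \<Rightarrow> nat \<Rightarrow> complex poly poly" where
  "iso_monomial d a = [:[:0, 1:], [:\<i>:]:] ^ a * [:[:0, 1:], [:- \<i>:]:] ^ (d - a)"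

text \<open>For non-zero \<open>b\<close> this spans the line orthogonal to
  \<open>b\<close>.\<close>

definition perp :: "complex ^ 2 \<Rightarrow> complex ^ 2" where
  "perp b = vector [- b $ 2, b $ 1]"

text \<open>On \<open>perp b + t b\<close> the coordinates are
  \<open>z = i (b1 + i b2) (1 - i t)\<close> and \<open>w = -i (b1 - i b2) (1 + i t)\<close>, so
  \<open>b\<close> enters only through constant factors.\<close>

lemma line_poly_iso_monomial:
  "line_poly (iso_monomial d a) (perp b) b =
     smult ((\<i> * (b $ 1 + \<i> * b $ 2)) ^ a * (- \<i> * (b $ 1 - \<i> * b $ 2)) ^ (d - a))
       ([:1, - \<i>:] ^ a * [:1, \<i>:] ^ (d - a))"
proof (rule iffD1[OF poly_eq_poly_eq_iff], rule ext)
  fix t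
  have 1: "eval2 [:[:0, 1:], [:\<i>:]:] (perp b + t *s b) = \<i> * (b $ 1 + \<i> * b $ 2) * (1 - t * \<i>)"
    by (simp add: eval2_def perp_def algebra_simps)
  have 2: "eval2 [:[:0, 1:], [:- \<i>:]:] (perp b + t *s b) = - \<i> * (b $ 1 - \<i> * b $ 2) * (1 + t * \<i>)"
    by (simp add: eval2_def perp_def algebra_simps)
  have 3: "poly [:1, - \<i>:] t = 1 - t * \<i>" "poly [:1, \<i>:] t = 1 + t * \<i>" by simp_all
  show "poly (line_poly (iso_monomial d a) (perp b) b) t = poly (smult ((\<i> * (b $ 1 + \<i> * b $ 2)) ^ a * (- \<i> * (b $ 1 - \<i> * b $ 2)) ^ (d - a))
       ([:1, - \<i>:] ^ a * [:1, \<i>:] ^ (d - a))) t"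
    unfolding poly_line_poly iso_monomial_def eval2_mult eval2_power 1 2
    by (simp only: poly_smult poly_mult poly_power 3 power_mult_distrib mult_ac)
qed

text \<open>\<open>angular_poly (2 M) s\<close> at \<open>a - M\<close> is the coefficient of \<open>t ^ s\<close> in
  \<open>y = (1 - i t) ^ a (1 + i t) ^ (2 M - a)\<close>; the recursion is the differential equation
  \<open>(1 + t\<^sup>2) y' = (2 M t - 2 i (a - M)) y\<close>.\<close>

fun angular_poly :: "nat \<Rightarrow> nat \<Rightarrow> complex poly" where
  "angular_poly d 0 = 1"
| "angular_poly d (Suc 0) = [:0, - 2 * \<i>:]"
| "angular_poly d (Suc (Suc s)) =
     smult (1 / of_nat (s + 2)) (smult (of_nat d - of_nat s) (angular_poly d s)
       + [:0, - 2 * \<i>:] * angular_poly d (Suc s))"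

lemma poly_angular_poly:
  assumes a: "a \<le> 2 * M"
  shows "poly (angular_poly (2 * M) s) (of_nat a - of_nat M)
    = coeff ([:1, - \<i>:] ^ a * [:1, \<i>:] ^ (2 * M - a)) s"
proof -
  define x :: complex where "x = of_nat a - of_nat M"
  define y where "y = [:1, - \<i>:] ^ a * [:1, \<i>:] ^ (2 * M - a)"
  have b: "of_nat (2 * M - a) = (of_nat M - x :: complex)" using a by (simp add: x_def of_nat_diff)
  have a': "of_nat a = of_nat M + x" by (simp add: x_def)
  have lin: "[:1, c:] * pderiv ([:1, c:] ^ k) = smult (of_nat k * c) ([:1, c:] ^ k)" for c :: complex and k
    by (cases k) (simp_all add: pderiv_power_Suc pderiv_pCons mult.commute del: power_Suc, simp)
  have "[:1, 0, 1:] * pderiv y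
      = [:1, \<i>:] * ([:1, - \<i>:] * pderiv ([:1, - \<i>:] ^ a)) * [:1, \<i>:] ^ (2 * M - a)
      + [:1, - \<i>:] * [:1, - \<i>:] ^ a * ([:1, \<i>:] * pderiv ([:1, \<i>:] ^ (2 * M - a)))"
  proof -
    \<comment> \<open>Each factor of \<open>1 + t^2\<close> restores the power lost in
      differentiating one of the two factors of \<open>y\<close>.\<close>
    have "[:1, 0, 1:] = [:1, \<i>:] * [:1, - \<i>:]" by simp
    then show ?thesis unfolding y_def pderiv_mult by (simp only: algebra_simps)
  qed
  also have "\<dots> = [:- 2 * \<i> * x, 2 * of_nat M:] * y"
    unfolding lin y_def b a'
    by (rule iffD1[OF poly_eq_poly_eq_iff], rule ext) (simp add: algebra_simps)
  finally have ode: "[:1, 0, 1:] * pderiv y = [:- 2 * \<i> * x, 2 * of_nat M:] * y" .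
  have y0: "coeff y 0 = 1"
    by (simp add: y_def poly_0_coeff_0[symmetric])
  have y1: "coeff y 1 = - 2 * \<i> * x"
    using arg_cong[OF ode, of "\<lambda>p. coeff p 0"] y0 by (simp add: coeff_pderiv)
  \<comment> \<open>Coefficients of \<open>t^(s+1)\<close> are compared; \<open>coeff y s\<close>
    occurs on both sides, whence the factor \<open>2M - s\<close>.\<close>
  have rec: "of_nat (s + 2) * coeff y (s + 2) = (of_nat (2 * M) - of_nat s) * coeff y s + - 2 * \<i> * x * coeff y (s + 1)" for s
    using arg_cong[OF ode, of "\<lambda>p. coeff p (Suc s)"]
    by (cases s) (simp_all add: coeff_pderiv algebra_simps)
  have "poly (angular_poly (2 * M) s) x = coeff y s"
  proof (induction "2 * M" s rule: angular_poly.induct)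
    case 1
    then show ?case using y0 by simp
  next
    case 2
    then show ?case using y1 by simp
  next
    case (3 s)
    have nz: "(of_nat (s + 2) :: complex) \<noteq> 0" unfolding of_nat_eq_0_iff by simp
    show ?case using 3 rec[of s] nz
      by (simp add: field_simps del: of_nat_add of_nat_Suc)
  qed
  then show ?thesis by (simp add: x_def y_def)
qed

lemma degree_angular_poly: "degree (angular_poly d s) \<le> s"
proof (induction d s rule: angular_poly.induct)
  case (3 d s)
  have "degree ([:0, - 2 * \<i>:] * angular_poly d (Suc s)) \<le> Suc (Suc s)"
    by (intro order.trans[OF degree_mult_le]) (use 3 in simp)
  then show ?case unfolding angular_poly.simps
    using 3 by (intro order.trans[OF degree_smult_le] degree_add_le) (auto intro: order.trans[OF degree_smult_le])
qed auto

lemma lead_coeff_angular_poly: "coeff (angular_poly d s) s \<noteq> 0"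
proof (induction d s rule: angular_poly.induct)
  case (3 d s)
  have "coeff (angular_poly d s) (Suc (Suc s)) = 0"
    using degree_angular_poly[of d s] by (intro coeff_eq_0) simp
  then show ?case using 3 by (simp del: of_nat_add of_nat_Suc)
qed auto

text \<open>This yields the factor \<open>a - M\<close> common to all the functionals.\<close>

lemma coeff_0_angular_poly_odd: "coeff (angular_poly d (2 * s + 1)) 0 = 0"
  by (induction s) simp_all

text \<open>The degrees are exactly \<open>2s - 1\<close>, hence distinct, so the top coefficient
  kills the last term and induction does the rest.\<close>

lemma odd_angular_poly_independent:
  assumes "(\<Sum>s\<in>{1..m}. smult (e s) (angular_poly d (2 * s - 1))) = 0" and "s \<in> {1..m}"
  shows "e s = 0"
  using assms
proof (induction m)
  case (Suc m)
  have "coeff (angular_poly d (2 * j - 1)) (2 * Suc m - 1) = 0" if "j \<in> {1..m}" for j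
    using degree_angular_poly[of d "2 * j - 1"] that by (intro coeff_eq_0) auto
  then have "coeff (\<Sum>s\<in>{1..Suc m}. smult (e s) (angular_poly d (2 * s - 1))) (2 * Suc m - 1)
     = e (Suc m) * coeff (angular_poly d (2 * Suc m - 1)) (2 * Suc m - 1)"
    by (simp add: coeff_sum)
  then have "e (Suc m) * coeff (angular_poly d (2 * Suc m - 1)) (2 * Suc m - 1) = 0"
    by (simp only: Suc.prems(1) coeff_0)
  then have "e (Suc m) = 0" using lead_coeff_angular_poly by simp
  then show ?case using Suc by (cases "s = Suc m") auto
qed simp

section \<open>Homogeneous polynomials\<close>

lemma homogeneous2_mult:
  assumes "homogeneous2 d p" "homogeneous2 e q"
  shows "homogeneous2 (d + e) (p * q)"
  unfolding homogeneous2_def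
proof (intro allI impI)
  fix i j
  assume "coeff (coeff (p * q) j) i \<noteq> 0"
  then have "(\<Sum>k\<le>j. \<Sum>l\<le>i. coeff (coeff p k) l * coeff (coeff q (j - k)) (i - l)) \<noteq> 0"
    by (simp add: coeff_mult coeff_sum)
  then obtain k l where "k \<le> j" "l \<le> i" "coeff (coeff p k) l * coeff (coeff q (j - k)) (i - l) \<noteq> 0"
    by (metis (no_types, lifting) atMost_iff sum.neutral)
  moreover from this have "l + k = d" "i - l + (j - k) = e"
    using assms by (auto simp: homogeneous2_def)
  ultimately show "i + j = d + e" by linarith
qed

lemma homogeneous2_power:
  assumes "homogeneous2 d p"
  shows "homogeneous2 (k * d) (p ^ k)"
proof (induction k)
  case 0
  then show ?case by (auto simp: homogeneous2_def coeff_1)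
next
  case (Suc k)
  then show ?case using homogeneous2_mult[OF assms] by simp
qed

lemma homogeneous2_iso_monomial:
  assumes "a \<le> d"
  shows "homogeneous2 d (iso_monomial d a)"
proof -
  have "homogeneous2 1 [:[:0, 1:], [:c:]:]" for c
    by (auto simp: homogeneous2_def coeff_pCons split: nat.splits)
  then have "homogeneous2 (a * 1 + (d - a) * 1) (iso_monomial d a)"
    unfolding iso_monomial_def by (intro homogeneous2_mult homogeneous2_power)
  then show ?thesis using assms by simp
qed

lemma homogeneous2_dir_deriv:
  assumes "homogeneous2 d p"
  shows "homogeneous2 (d - 1) (dir_deriv b p)"
  unfolding homogeneous2_def
proof (intro allI impI)
  fix i j
  assume "coeff (coeff (dir_deriv b p) j) i \<noteq> 0"
  then have "coeff (coeff p j) (Suc i) \<noteq> 0 \<or> coeff (coeff p (Suc j)) i \<noteq> 0"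
    by (auto simp: dir_deriv_def scale2_def coeff_map_poly coeff_pderiv of_nat_poly)
  then have "Suc i + j = d \<or> i + Suc j = d" using assms unfolding homogeneous2_def by blast
  \<comment> \<open>For \<open>d = 0\<close> neither alternative can hold, so the truncated
    subtraction is harmless.\<close>
  then show "i + j = d - 1" by auto
qed

lemma homogeneous2_dir_deriv_power:
  assumes "homogeneous2 d p"
  shows "homogeneous2 (d - k) ((dir_deriv b ^^ k) p)"
proof (induction k)
  case (Suc k)
  then show ?case using homogeneous2_dir_deriv by fastforce
qed (use assms in simp)

lemma eval2_homogeneous2:
  assumes "homogeneous2 d p"
  shows "eval2 p (c *s x) = c ^ d * eval2 p x"
proof -
  have e: "eval2 p y = (\<Sum>j\<le>degree p. \<Sum>i\<le>degree (coeff p j). coeff (coeff p j) i * y $ 1 ^ i * y $ 2 ^ j)" for y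
  proof -
    have "poly p [:y $ 2:] = (\<Sum>j\<le>degree p. coeff p j * [:y $ 2 ^ j:])"
      by (simp add: poly_altdef poly_const_pow)
    then show ?thesis
      by (simp add: eval2_def poly_sum) (simp add: poly_altdef sum_distrib_left algebra_simps)
  qed
  show ?thesis unfolding e sum_distrib_left
  proof (intro sum.cong refl)
    fix i j
    show "coeff (coeff p j) i * (c *s x) $ 1 ^ i * (c *s x) $ 2 ^ j
       = c ^ d * (coeff (coeff p j) i * x $ 1 ^ i * x $ 2 ^ j)"
    proof (cases "coeff (coeff p j) i = 0")
      case False
      then have "d = i + j" using assms by (simp add: homogeneous2_def)
      then show ?thesis by (simp add: power_add power_mult_distrib algebra_simps)
    qed simp
  qed
qed

section \<open>The dimension of the space of homogeneous polynomials\<close>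

lemma linear_scale2I:
  assumes "\<And>p q. F (p + q) = F p + F q" "\<And>c p. F (scale2 c p) = c * F p"
  shows "Vector_Spaces.linear scale2 (*) (F :: complex poly poly \<Rightarrow> complex)"
proof -
  interpret vector_space scale2 by (rule vector_space_scale2)
  show ?thesis by unfold_locales (simp_all add: assms algebra_simps)
qed

lemma subspace_homogeneous2: "module.subspace scale2 {p. homogeneous2 d p}"
proof -
  interpret vector_space scale2 by (rule vector_space_scale2)
  show ?thesis
  proof (rule subspaceI)
    show "p + q \<in> {p. homogeneous2 d p}"
      if "p \<in> {p. homogeneous2 d p}" "q \<in> {p. homogeneous2 d p}" for p q
      using that unfolding homogeneous2_def mem_Collect_eq coeff_add by (metis add_0)
  qed (auto simp: homogeneous2_def scale2_def)
qed

lemma homogeneous2_subset_span: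
  "{p. homogeneous2 d p} \<subseteq> module.span scale2 ((\<lambda>j. monom (monom 1 (d - j)) j) ` {..d})"
proof
  interpret vector_space scale2 by (rule vector_space_scale2)
  fix p assume "p \<in> {p. homogeneous2 d p}"
  then have p: "homogeneous2 d p" by simp
  have "p = (\<Sum>j\<le>d. scale2 (coeff (coeff p j) (d - j)) (monom (monom 1 (d - j)) j))"
  proof (rule poly_eqI, rule poly_eqI)
    fix j i
    have "coeff (coeff (\<Sum>j\<le>d. scale2 (coeff (coeff p j) (d - j)) (monom (monom 1 (d - j)) j)) j) i
      = (\<Sum>k\<le>d. if k = j then if d - j = i then coeff (coeff p j) i else 0 else 0)"
      unfolding coeff_sum by (rule sum.cong) (auto simp: scale2_def)
    also have "\<dots> = coeff (coeff p j) i"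
    proof (cases "i + j = d")
      case True
      then show ?thesis by auto
    next
      case False
      then have "coeff (coeff p j) i = 0" using p unfolding homogeneous2_def by blast
      then show ?thesis by simp
    qed
    finally show "coeff (coeff p j) i = coeff (coeff (\<Sum>j\<le>d. scale2 (coeff (coeff p j) (d - j)) (monom (monom 1 (d - j)) j)) j) i" ..
  qed
  also have "\<dots> \<in> span ((\<lambda>j. monom (monom 1 (d - j)) j) ` {..d})"
    by (intro span_sum span_scale span_base) auto
  finally show "p \<in> span ((\<lambda>j. monom (monom 1 (d - j)) j) ` {..d})" .
qed

text \<open>The \<open>d + 1\<close> coefficient functionals are independent and their common kernel
  is zero.\<close>

lemma dim_homogeneous2: "vector_space.dim scale2 {p. homogeneous2 d p} = d + 1"
proof -
  interpret vector_space scale2 by (rule vector_space_scale2)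
  define L :: "nat \<Rightarrow> complex poly poly \<Rightarrow> complex" where "L = (\<lambda>j p. coeff (coeff p j) (d - j))"
  have "dim {p. homogeneous2 d p} = dim {p \<in> {p. homogeneous2 d p}. \<forall>j\<in>{..d}. L j p = 0} + card {..d}"
  proof (rule dim_common_kernel[OF subspace_homogeneous2 _ homogeneous2_subset_span])
    show "Vector_Spaces.linear scale2 (*) (L j)" for j
      by (rule linear_scale2I) (simp_all add: L_def scale2_def)
    fix c
    assume c: "\<And>p. p \<in> {p. homogeneous2 d p} \<Longrightarrow> (\<Sum>j\<le>d. c j * L j p) = 0"
    show "\<forall>j\<in>{..d}. c j = 0"
    proof
      fix k assume k: "k \<in> {..d}"
      define p :: "complex poly poly" where "p = monom (monom 1 (d - k)) k"
      have "homogeneous2 d p" using k by (auto simp: p_def homogeneous2_def split: if_splits)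
      then have "0 = (\<Sum>j\<le>d. c j * L j p)" using c by simp
      also have "\<dots> = (\<Sum>j\<le>d. if j = k then c j else 0)"
        by (rule sum.cong) (auto simp: L_def p_def)
      finally show "c k = 0" using k by simp
    qed
  qed simp_all
  also have "{p \<in> {p. homogeneous2 d p}. \<forall>j\<in>{..d}. L j p = 0} = {0}"
  proof -
    have "p = 0" if p: "homogeneous2 d p" "\<forall>j\<in>{..d}. L j p = 0" for p
    proof (rule poly_eqI, rule poly_eqI)
      fix i j
      show "coeff (coeff p j) i = coeff (coeff 0 j) i"
      proof (cases "i + j = d")
        case True
        then have "i = d - j" "j \<le> d" by auto
        then show ?thesis using p(2) by (simp add: L_def)
      qed (use p(1) in \<open>auto simp: homogeneous2_def\<close>)
    qed
    then show ?thesis by (auto simp: homogeneous2_def L_def)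
  qed
  also have "dim {0} = 0" using dim_eq_card_independent[OF independent_empty] dim_span[of "{}"] by simp
  finally show ?thesis by simp
qed

text \<open>Each condition concerns a homogeneous polynomial on a line through the origin, so it may
  be tested at one spanning vector.\<close>

lemma quasi_invariant_iff_perp:
  assumes cfg: "configuration n \<beta>" and p: "homogeneous2 d p"
  shows "quasi_invariant n \<beta> \<mu> p \<longleftrightarrow>
    (\<forall>i\<le>n. \<forall>s\<in>{1..\<mu> i}. eval2 ((dir_deriv (\<beta> i) ^^ (2 * s - 1)) p) (perp (\<beta> i)) = 0)"
proof
  assume "quasi_invariant n \<beta> \<mu> p"
  moreover have "scalar_product (\<beta> i) (perp (\<beta> i)) = 0" for i
    by (simp add: scalar_product_def sum_2 perp_def)
  ultimately show "\<forall>i\<le>n. \<forall>s\<in>{1..\<mu> i}. eval2 ((dir_deriv (\<beta> i) ^^ (2 * s - 1)) p) (perp (\<beta> i)) = 0"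
    by (simp add: quasi_invariant_def)
next
  assume *: "\<forall>i\<le>n. \<forall>s\<in>{1..\<mu> i}. eval2 ((dir_deriv (\<beta> i) ^^ (2 * s - 1)) p) (perp (\<beta> i)) = 0"
  show "quasi_invariant n \<beta> \<mu> p"
    unfolding quasi_invariant_def
  proof (intro allI impI ballI)
    fix i s and x :: "complex ^ 2"
    assume i: "i \<le> n" and s: "s \<in> {1..\<mu> i}" and x: "scalar_product (\<beta> i) x = 0"
    define b1 b2 where "b1 = \<beta> i $ 1" and "b2 = \<beta> i $ 2"
    define N where "N = b1 * b1 + b2 * b2"
    \<comment> \<open>The coordinate of \<open>x\<close> along \<open>perp (\<beta> i)\<close>,
      obtained by pairing \<open>x\<close> with that vector.\<close>
    define r where "r = (b1 * x $ 2 - b2 * x $ 1) / N"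
    have N: "N \<noteq> 0" using cfg i
      by (auto simp: configuration_def scalar_product_def sum_2 N_def b1_def b2_def)
    have x': "b1 * x $ 1 + b2 * x $ 2 = 0"
      using x by (simp add: scalar_product_def sum_2 b1_def b2_def)
    have "N * x $ 1 = - (b1 * x $ 2 - b2 * x $ 1) * b2" "N * x $ 2 = (b1 * x $ 2 - b2 * x $ 1) * b1"
      using x' unfolding N_def by algebra+
    then have "x $ 1 = - r * b2" "x $ 2 = r * b1"
      using N by (simp_all add: r_def field_simps)
    then have "x = r *s perp (\<beta> i)"
      by (simp add: vec_eq_iff forall_2 perp_def b1_def b2_def)
    then show "eval2 ((dir_deriv (\<beta> i) ^^ (2 * s - 1)) p) x = 0"
      using * i s eval2_homogeneous2[OF homogeneous2_dir_deriv_power[OF p]] by simp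
  qed
qed

section \<open>Isotropic ratios and the exceptional configuration\<close>

text \<open>For a non-zero multiple of \<open>(cos \<phi>, sin \<phi>)\<close> this is
  \<open>exp (2 i \<phi>)\<close>.\<close>

definition iso_ratio :: "complex ^ 2 \<Rightarrow> complex" where
  "iso_ratio b = (b $ 1 + \<i> * b $ 2) / (b $ 1 - \<i> * b $ 2)"

lemma iso_factors:
  fixes b :: "complex ^ 2"
  shows "(b $ 1 + \<i> * b $ 2) * (b $ 1 - \<i> * b $ 2) = scalar_product b b"
  by (simp add: scalar_product_def sum_2 algebra_simps)

lemma iso_factors_nonzero:
  assumes "scalar_product b b \<noteq> 0"
  shows "b $ 1 + \<i> * b $ 2 \<noteq> 0" "b $ 1 - \<i> * b $ 2 \<noteq> 0" "iso_ratio b \<noteq> 0"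
  using assms iso_factors[of b] by (auto simp: iso_ratio_def)

text \<open>Cross-multiplied, equal ratios say that the determinant of the two vectors vanishes,
  which contradicts non-collinearity.\<close>

lemma iso_ratio_inj:
  assumes cfg: "configuration n \<beta>" and i: "i \<le> n" and j: "j \<le> n"
    and eq: "iso_ratio (\<beta> i) = iso_ratio (\<beta> j)"
  shows "i = j"
proof (rule ccontr)
  assume "i \<noteq> j"
  then have nc: "\<beta> j \<noteq> c *s \<beta> i" for c using cfg i j by (auto simp: configuration_def)
  have ni: "scalar_product (\<beta> i) (\<beta> i) \<noteq> 0" "scalar_product (\<beta> j) (\<beta> j) \<noteq> 0"
    using cfg i j by (auto simp: configuration_def)
  define a b c d where "a = \<beta> i $ 1" and "b = \<beta> i $ 2" and "c = \<beta> j $ 1" and "d = \<beta> j $ 2"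
  have "(a + \<i> * b) * (c - \<i> * d) = (c + \<i> * d) * (a - \<i> * b)"
    using eq iso_factors_nonzero(2)[OF ni(1)] iso_factors_nonzero(2)[OF ni(2)]
    by (simp add: iso_ratio_def frac_eq_eq a_def b_def c_def d_def)
  then have "2 * \<i> * (b * c - a * d) = 0" by (simp add: algebra_simps)
  then have e: "b * c = a * d" by simp
  have "a \<noteq> 0 \<or> b \<noteq> 0" using iso_factors_nonzero(1)[OF ni(1)] by (auto simp: a_def b_def)
  then show False
  proof
    assume "a \<noteq> 0"
    then have "\<beta> j = (c / a) *s \<beta> i" using e
      by (simp add: vec_eq_iff forall_2 a_def b_def c_def d_def field_simps)
    then show False using nc by blast
  next
    assume "b \<noteq> 0"
    then have "\<beta> j = (d / b) *s \<beta> i" using e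
      by (simp add: vec_eq_iff forall_2 a_def b_def c_def d_def field_simps)
    then show False using nc by blast
  qed
qed

text \<open>The inverse of \<open>x + i y\<close> is \<open>x - i y\<close>, so a complex logarithm
  of \<open>x + i y\<close> supplies the angle.\<close>

lemma cos_sin_of_unit:
  fixes x y :: complex
  assumes "x * x + y * y = 1"
  obtains \<phi> where "cos \<phi> = x" "sin \<phi> = y"
proof -
  have u: "(x + \<i> * y) * (x - \<i> * y) = 1" using assms by (simp add: algebra_simps)
  then have nz: "x + \<i> * y \<noteq> 0" by auto
  define \<phi> where "\<phi> = - \<i> * Ln (x + \<i> * y)"
  have 1: "exp (\<i> * \<phi>) = x + \<i> * y" using nz by (simp add: \<phi>_def algebra_simps flip: mult.assoc)
  have 2: "exp (- (\<i> * \<phi>)) = x - \<i> * y"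
    using u nz by (simp add: exp_minus 1 field_simps)
  show ?thesis
  proof
    show "cos \<phi> = x" by (simp add: cos_exp_eq 1 2)
    show "sin \<phi> = y" by (simp add: sin_exp_eq 1 2)
  qed
qed

text \<open>A complex rotation takes the zeroth vector to the first axis, and all vectors are
  normalised. The rotation divides every isotropic ratio by that of the zeroth vector, which turns
  \<open>e\<close> into the conditions on the angles.\<close>

lemma config_equiv_is_A_m1:
  assumes cfg: "configuration n \<beta>"
    and e: "\<And>k. k \<in> {1..n} \<Longrightarrow> elem_sym k n (\<lambda>s. iso_ratio (\<beta> s) / iso_ratio (\<beta> 0)) =
           (-1) ^ k * of_nat (n choose k) * of_nat ((m + k - 1) choose k)
             / of_nat ((m + n - 1) choose k)"
  shows "\<exists>\<gamma>. is_A_m1 m n \<gamma> \<and> config_equiv n \<beta> \<mu> \<gamma> \<mu>"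
proof -
  have ni: "scalar_product (\<beta> i) (\<beta> i) \<noteq> 0" if "i \<le> n" for i
    using cfg that by (auto simp: configuration_def)
  \<comment> \<open>A complex length; only its square and its being non-zero matter, so either root
    would do.\<close>
  define q where "q i = csqrt (scalar_product (\<beta> i) (\<beta> i))" for i
  have q: "q i \<noteq> 0" "q i * q i = \<beta> i $ 1 * \<beta> i $ 1 + \<beta> i $ 2 * \<beta> i $ 2" if "i \<le> n" for i
  proof -
    have "q i ^ 2 = scalar_product (\<beta> i) (\<beta> i)" by (simp add: q_def)
    then show "q i * q i = \<beta> i $ 1 * \<beta> i $ 1 + \<beta> i $ 2 * \<beta> i $ 2"
      by (simp add: power2_eq_square scalar_product_def sum_2)
    show "q i \<noteq> 0" using ni[OF that] by (simp add: q_def)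
  qed
  define c s where "c = \<beta> 0 $ 1 / q 0" and "s = \<beta> 0 $ 2 / q 0"
  have cs: "c * c + s * s = 1"
  proof -
    have "c * c + s * s = (q 0 * q 0) / (q 0 * q 0)"
      by (simp only: q(2)[of 0, simplified] c_def s_def times_divide_times_eq add_divide_distrib)
    then show ?thesis using q(1)[of 0] by simp
  qed
  define T :: "complex ^ 2 \<Rightarrow> complex ^ 2" where
    "T u = vector [c * u $ 1 + s * u $ 2, c * u $ 2 - s * u $ 1]" for u
  have T: "T u $ 1 = c * u $ 1 + s * u $ 2" "T u $ 2 = c * u $ 2 - s * u $ 1" for u
    by (simp_all add: T_def)
  have lin: "Vector_Spaces.linear (*s) (*s) T"
    by unfold_locales (simp_all add: vec_eq_iff forall_2 T algebra_simps)
  have orth: "scalar_product (T u) (T v) = scalar_product u v" for u v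
    unfolding scalar_product_def sum_2 T using cs by algebra
  have T0: "T (\<beta> 0) = vector [q 0, 0]"
  proof -
    have "c * \<beta> 0 $ 1 + s * \<beta> 0 $ 2 = (q 0 * q 0) / q 0"
      by (simp only: q(2)[of 0, simplified] c_def s_def times_divide_eq_left add_divide_distrib)
    then show ?thesis using q(1)[of 0]
      by (simp add: vec_eq_iff forall_2 T) (simp add: c_def s_def)
  qed
  have "\<exists>\<phi>. cos \<phi> = T (\<beta> i) $ 1 / q i \<and> sin \<phi> = T (\<beta> i) $ 2 / q i" if i: "i \<le> n" for i
  proof -
    have "T (\<beta> i) $ 1 * T (\<beta> i) $ 1 + T (\<beta> i) $ 2 * T (\<beta> i) $ 2 = q i * q i"
      using orth[of "\<beta> i" "\<beta> i"] q(2)[OF i] by (simp add: scalar_product_def sum_2)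
    then have "(T (\<beta> i) $ 1 / q i) * (T (\<beta> i) $ 1 / q i) + (T (\<beta> i) $ 2 / q i) * (T (\<beta> i) $ 2 / q i) = 1"
      using q(1)[OF i] by (simp add: divide_simps)
    then show ?thesis by (metis cos_sin_of_unit)
  qed
  then obtain \<phi> where \<phi>: "\<And>i. i \<le> n \<Longrightarrow> cos (\<phi> i) = T (\<beta> i) $ 1 / q i"
    "\<And>i. i \<le> n \<Longrightarrow> sin (\<phi> i) = T (\<beta> i) $ 2 / q i" by metis
  define \<gamma> :: "nat \<Rightarrow> complex ^ 2" where "\<gamma> i = vector [cos (\<phi> i), sin (\<phi> i)]" for i
  have \<gamma>: "\<gamma> i = (1 / q i) *s T (\<beta> i)" if "i \<le> n" for i
    using \<phi>[OF that] by (simp add: \<gamma>_def vec_eq_iff forall_2)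
  have ratio: "exp (2 * \<i> * \<phi> i) = iso_ratio (\<beta> i) / iso_ratio (\<beta> 0)" if i: "i \<le> n" for i
  proof -
    have p: "exp (\<i> * \<phi> i) = (T (\<beta> i) $ 1 + \<i> * T (\<beta> i) $ 2) / q i"
      using \<phi>[OF i] exp_Euler[of "\<phi> i"] by (simp add: add_divide_distrib)
    have n: "exp (- (\<i> * \<phi> i)) = (T (\<beta> i) $ 1 - \<i> * T (\<beta> i) $ 2) / q i"
      using \<phi>[OF i] exp_minus_Euler[of "\<phi> i"] by (simp add: diff_divide_distrib)
    have "exp (2 * \<i> * \<phi> i) = exp (\<i> * \<phi> i) / exp (- (\<i> * \<phi> i))"
      by (simp add: mult.assoc flip: exp_diff)
    also have "\<dots> = (T (\<beta> i) $ 1 + \<i> * T (\<beta> i) $ 2) / (T (\<beta> i) $ 1 - \<i> * T (\<beta> i) $ 2)"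
      unfolding p n using q(1)[OF i] by simp
    \<comment> \<open>The rotation multiplies \<open>u1 + i u2\<close> by \<open>c - i s\<close> and
      \<open>u1 - i u2\<close> by \<open>c + i s\<close>.\<close>
    also have "T (\<beta> i) $ 1 + \<i> * T (\<beta> i) $ 2 = (\<beta> 0 $ 1 - \<i> * \<beta> 0 $ 2) * (\<beta> i $ 1 + \<i> * \<beta> i $ 2) / q 0"
      using q(1)[of 0] by (simp add: T c_def s_def field_simps)
    also have "T (\<beta> i) $ 1 - \<i> * T (\<beta> i) $ 2 = (\<beta> 0 $ 1 + \<i> * \<beta> 0 $ 2) * (\<beta> i $ 1 - \<i> * \<beta> i $ 2) / q 0"
      using q(1)[of 0] by (simp add: T c_def s_def field_simps)
    finally show ?thesis using q(1)[of 0] by (simp add: iso_ratio_def mult.commute)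
  qed
  have "is_A_m1 m n \<gamma>"
    unfolding is_A_m1_def
  proof (intro exI[of _ \<phi>] conjI ballI allI impI)
    show "\<gamma> 0 = vector [1, 0]"
      using q(1)[of 0] by (simp add: \<gamma> T0 vec_eq_iff forall_2)
    fix k assume k: "k \<in> {1..n}"
    have "elem_sym k n (\<lambda>s. exp (2 * \<i> * \<phi> s)) = elem_sym k n (\<lambda>s. iso_ratio (\<beta> s) / iso_ratio (\<beta> 0))"
      unfolding elem_sym_def by (intro sum.cong prod.cong refl ratio) auto
    then show "elem_sym k n (\<lambda>s. exp (2 * \<i> * \<phi> s)) = (-1) ^ k * of_nat (n choose k) * of_nat ((m + k - 1) choose k)
             / of_nat ((m + n - 1) choose k)"
      using e[OF k] by simp
  qed (simp add: \<gamma>_def)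
  moreover have "config_equiv n \<beta> \<mu> \<gamma> \<mu>"
    unfolding config_equiv_def
    by (intro exI[of _ T] exI[of _ id] exI[of _ "\<lambda>i. 1 / q i"]) (use lin orth q(1) \<gamma> in auto)
  ultimately show ?thesis by blast
qed

section \<open>Independence of the quasi-invariance conditions\<close>

text \<open>The dependence on \<open>a\<close> is separated into a power of the isotropic ratio and
  a polynomial in \<open>a - M\<close>; the remaining factor does not involve
  \<open>a\<close>.\<close>

lemma functional_iso_monomial:
  assumes b: "scalar_product b b \<noteq> 0" and a: "a \<le> 2 * M"
  shows "eval2 ((dir_deriv b ^^ s) (iso_monomial (2 * M) a)) (perp b)
    = fact s * (- \<i> * (b $ 1 - \<i> * b $ 2)) ^ (2 * M) * (- iso_ratio b) ^ a
      * poly (angular_poly (2 * M) s) (of_nat a - of_nat M)"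
proof -
  have nz: "b $ 1 - \<i> * b $ 2 \<noteq> 0" using iso_factors_nonzero(2)[OF b] .
  define w where "w = - \<i> * (b $ 1 - \<i> * b $ 2)"
  have z: "\<i> * (b $ 1 + \<i> * b $ 2) = - iso_ratio b * w"
    using nz by (simp add: iso_ratio_def w_def)
  have "(\<i> * (b $ 1 + \<i> * b $ 2)) ^ a * w ^ (2 * M - a) = (- iso_ratio b) ^ a * (w ^ a * w ^ (2 * M - a))"
    unfolding z power_mult_distrib by (simp only: mult.assoc)
  also have "w ^ a * w ^ (2 * M - a) = w ^ (2 * M)" using a by (simp flip: power_add)
  finally have "(\<i> * (b $ 1 + \<i> * b $ 2)) ^ a * w ^ (2 * M - a) = (- iso_ratio b) ^ a * w ^ (2 * M)" .
  then show ?thesis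
    unfolding eval2_dir_deriv_power line_poly_iso_monomial coeff_smult poly_angular_poly[OF a] w_def
    by (simp only: mult_ac)
qed

lemma sum_mult_m1:
  "(\<Sum>(i, s)\<in>(SIGMA i:{..n}. {1..mult_m1 m i}). f i s)
     = (\<Sum>s\<in>{1..m}. f 0 s) + (\<Sum>i\<in>{1..n}. f i 1)"
  for f :: "nat \<Rightarrow> nat \<Rightarrow> 'a :: comm_monoid_add"
proof -
  have "{..n} = insert 0 {1..n}" by auto
  then have "(\<Sum>i\<le>n. \<Sum>s\<in>{1..mult_m1 m i}. f i s)
      = (\<Sum>s\<in>{1..m}. f 0 s) + (\<Sum>i\<in>{1..n}. \<Sum>s\<in>{1..mult_m1 m i}. f i s)"
    by (simp add: mult_m1_def)
  also have "(\<Sum>i\<in>{1..n}. \<Sum>s\<in>{1..mult_m1 m i}. f i s) = (\<Sum>i\<in>{1..n}. f i 1)"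
    by (rule sum.cong) (auto simp: mult_m1_def)
  finally show ?thesis by (simp add: sum.Sigma)
qed

text \<open>A relation between the conditions is tested on the isotropic monomials, where it becomes
  the vanishing of an exponential polynomial times \<open>a - M\<close>.\<close>

lemma conditions_independent:
  fixes C :: "nat \<Rightarrow> nat \<Rightarrow> complex"
  assumes m: "m \<ge> 1" and n: "n \<ge> 1" and cfg: "configuration n \<beta>"
    and notA: "\<not> (\<exists>\<gamma>. is_A_m1 m n \<gamma> \<and> config_equiv n \<beta> (mult_m1 m) \<gamma> (mult_m1 m))"
    and zero: "\<And>a. a \<le> 2 * (m + n - 1) \<Longrightarrow>
      (\<Sum>(i, s)\<in>(SIGMA i:{..n}. {1..mult_m1 m i}). C i s *
        eval2 ((dir_deriv (\<beta> i) ^^ (2 * s - 1)) (iso_monomial (2 * (m + n - 1)) a)) (perp (\<beta> i))) = 0"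
  shows "(\<forall>s\<in>{1..m}. C 0 s = 0) \<and> (\<forall>i\<in>{1..n}. C i 1 = 0)"
proof (rule ccontr)
  assume nontriv: "\<not> ?thesis"
  define M where "M = m + n - 1"
  have ni: "scalar_product (\<beta> i) (\<beta> i) \<noteq> 0" if "i \<le> n" for i
    using cfg that by (auto simp: configuration_def)
  define K where "K i = (- \<i> * (\<beta> i $ 1 - \<i> * \<beta> i $ 2)) ^ (2 * M)" for i
  have K: "K i \<noteq> 0" if "i \<le> n" for i
    using iso_factors_nonzero(2)[OF ni[OF that]] by (simp add: K_def)
  define t where "t i = iso_ratio (\<beta> i)" for i
  have t: "t i \<noteq> 0" if "i \<le> n" for i using iso_factors_nonzero(3)[OF ni[OF that]] by (simp add: t_def)
  \<comment> \<open>Dividing by the ratio of the zeroth vector makes the contribution of that vector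
    a pure polynomial in \<open>a\<close>.\<close>
  define z where "z i = t i / t 0" for i
  have tz: "(- t i) ^ a = (- t 0) ^ a * z i ^ a" for i a
  proof -
    have "- t i = - t 0 * z i" using t[of 0] by (simp add: z_def)
    then show ?thesis by (simp only: power_mult_distrib)
  qed
  define e where "e s = C 0 s * fact (2 * s - 1) * K 0" for s
  \<comment> \<open>The factor \<open>-2 i\<close> is the slope of
    \<open>angular_poly (2 * M) 1\<close>.\<close>
  define c where "c i = C i 1 * K i * (- 2 * \<i>)" for i
  define EE where "EE = (\<Sum>s\<in>{1..m}. smult (e s) (angular_poly (2 * M) (2 * s - 1)))"
  have "coeff (angular_poly (2 * M) (2 * s - 1)) 0 = 0" if "s \<in> {1..m}" for s
    using coeff_0_angular_poly_odd[of "2 * M" "s - 1"] that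
    by (cases s) auto
  then have EE0: "coeff EE 0 = 0" by (simp add: EE_def coeff_sum)
  obtain E where E: "EE = pCons 0 E" using EE0 by (cases EE) auto
  have "degree (angular_poly (2 * M) (2 * s - 1)) \<le> 2 * m - 1" if "s \<in> {1..m}" for s
    using degree_angular_poly[of "2 * M" "2 * s - 1"] that by auto
  then have "degree EE \<le> 2 * m - 1" unfolding EE_def
    by (intro degree_sum_le order.trans[OF degree_smult_le]) auto
  then have degE: "degree E \<le> 2 * m - 2" by (cases "E = 0") (auto simp: E)
  have val: "(- t 0) ^ a * ((of_nat a - of_nat M) * ((\<Sum>i\<in>{1..n}. c i * z i ^ a) + poly E (of_nat a - of_nat M))) = 0"
    if a: "a \<le> 2 * M" for a
  proof -
    define x :: complex where "x = of_nat a - of_nat M"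
    have val: "eval2 ((dir_deriv (\<beta> i) ^^ s) (iso_monomial (2 * M) a)) (perp (\<beta> i))
      = fact s * K i * (- t i) ^ a * poly (angular_poly (2 * M) s) x" if "i \<le> n" for i s
      using functional_iso_monomial[OF ni[OF that] a] by (simp only: K_def t_def x_def)
    have val1: "eval2 (dir_deriv (\<beta> i) (iso_monomial (2 * M) a)) (perp (\<beta> i))
      = K i * (- t i) ^ a * poly (angular_poly (2 * M) 1) x" if "i \<le> n" for i
      using val[OF that, of 1] by simp
    have "0 = (\<Sum>s\<in>{1..m}. C 0 s * (fact (2 * s - 1) * K 0 * (- t 0) ^ a * poly (angular_poly (2 * M) (2 * s - 1)) x))
       + (\<Sum>i\<in>{1..n}. C i 1 * (fact 1 * K i * (- t i) ^ a * poly (angular_poly (2 * M) 1) x))"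
      using zero[of a, folded M_def, OF a] unfolding sum_mult_m1 by (simp add: val val1)
    also have "(\<Sum>s\<in>{1..m}. C 0 s * (fact (2 * s - 1) * K 0 * (- t 0) ^ a * poly (angular_poly (2 * M) (2 * s - 1)) x))
       = (- t 0) ^ a * poly EE x"
      by (simp add: EE_def e_def poly_sum sum_distrib_left mult_ac)
    also have "\<dots> = (- t 0) ^ a * (x * poly E x)" by (simp add: E)
    also have "(\<Sum>i\<in>{1..n}. C i 1 * (fact 1 * K i * (- t i) ^ a * poly (angular_poly (2 * M) 1) x))
       = (- t 0) ^ a * (x * (\<Sum>i\<in>{1..n}. c i * z i ^ a))"
    proof -
      have "C i 1 * (fact 1 * K i * (- t i) ^ a * poly (angular_poly (2 * M) 1) x)
          = (- t 0) ^ a * (x * (c i * z i ^ a))" for i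
        unfolding tz[of i] by (simp add: c_def mult_ac)
      then show ?thesis by (simp only: sum_distrib_left)
    qed
    finally show ?thesis by (simp add: x_def algebra_simps)
  qed
  have "elem_sym k n z = (-1) ^ k * of_nat (n choose k) * of_nat ((m + k - 1) choose k)
             / of_nat ((m + n - 1) choose k)" if k: "k \<in> {1..n}" for k
  proof (rule elem_sym_of_dependence[OF m n, where E = E and c = c])
    show "k \<le> n" using k by simp
    show "inj_on z {1..n}"
      using iso_ratio_inj[OF cfg] t[of 0] by (intro inj_onI) (simp add: z_def t_def)
    show "z i \<noteq> 1" if "i \<in> {1..n}" for i
      using iso_ratio_inj[OF cfg, of i 0] that t[of 0] by (auto simp: z_def t_def)
    show "degree E \<le> 2 * m - 2" by (rule degE)
    show "(\<exists>i\<in>{1..n}. c i \<noteq> 0) \<or> E \<noteq> 0"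
    proof (rule ccontr)
      assume *: "\<not> ?thesis"
      then have "EE = 0" by (simp add: E)
      then have "e s = 0" if "s \<in> {1..m}" for s
        using odd_angular_poly_independent that unfolding EE_def by blast
      then have "C 0 s = 0" if "s \<in> {1..m}" for s using that K[of 0] by (simp add: e_def)
      moreover have "C i 1 = 0" if "i \<in> {1..n}" for i
      proof -
        have "c i = 0" "i \<le> n" using * that by auto
        then show ?thesis using K[of i] by (simp add: c_def)
      qed
      ultimately show False using nontriv by blast
    qed
    show "(\<Sum>i\<in>{1..n}. c i * z i ^ a) + poly E (of_nat a - of_nat (m + n - 1)) = 0"
      if "a \<le> 2 * (m + n - 1)" "a \<noteq> m + n - 1" for a
    proof -
      \<comment> \<open>Cancelling the common factor \<open>a - M\<close> is possible only off the
        centre, which is why \<open>a = M\<close> is excluded.\<close>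
      have "(of_nat a - of_nat M :: complex) \<noteq> 0" using that(2) by (simp only: M_def right_minus_eq of_nat_eq_iff not_False_eq_True)
      moreover have "a \<le> 2 * M" using that(1) by (simp only: M_def)
      ultimately show ?thesis unfolding M_def[symmetric] using val[of a] t[of 0] by simp
    qed
  qed
  then show False
    using config_equiv_is_A_m1[OF cfg, of m "mult_m1 m"] notA unfolding z_def t_def by blast
qed

section \<open>The dimension count\<close>

theorem proposition6p18:
  fixes m n :: nat and \<beta> :: "nat \<Rightarrow> complex ^ 2"
  assumes "m \<ge> 1" and "n \<ge> 1"
    and "configuration n \<beta>"
    and "\<not> (\<exists>\<gamma>. is_A_m1 m n \<gamma> \<and> config_equiv n \<beta> (mult_m1 m) \<gamma> (mult_m1 m))"
  shows "vector_space.dim scale2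
           (hom_quasi_invariants n \<beta> (mult_m1 m) (2 * (m + n - 1))) = m + n - 1"
proof -
  interpret vector_space scale2 by (rule vector_space_scale2)
  define d where "d = 2 * (m + n - 1)"
  define J where "J = (SIGMA i:{..n}. {1..mult_m1 m i})"
  define L where "L = (\<lambda>(i, s) p. eval2 ((dir_deriv (\<beta> i) ^^ (2 * s - 1)) p) (perp (\<beta> i)))"
  have "card J = (\<Sum>(i, s)\<in>J. 1)" by (simp add: split_def)
  also have "\<dots> = m + n" unfolding J_def sum_mult_m1 by simp
  finally have card: "card J = m + n" .
  have "dim {p. homogeneous2 d p} = dim {p \<in> {p. homogeneous2 d p}. \<forall>j\<in>J. L j p = 0} + card J"
  proof (rule dim_common_kernel[OF subspace_homogeneous2 _ homogeneous2_subset_span])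
    show "finite J" by (simp add: J_def)
    have add: "(dir_deriv b ^^ k) (p + q) = (dir_deriv b ^^ k) p + (dir_deriv b ^^ k) q" for b k p q
      by (induction k) (simp_all add: dir_deriv_add)
    have scale: "(dir_deriv b ^^ k) (scale2 c p) = scale2 c ((dir_deriv b ^^ k) p)" for b k c p
      by (induction k) (simp_all add: dir_deriv_scale2)
    show "Vector_Spaces.linear scale2 (*) (L j)" for j
      by (rule linear_scale2I) (simp_all add: L_def split_def add scale eval2_add eval2_scale2)
    fix C
    assume C: "\<And>p. p \<in> {p. homogeneous2 d p} \<Longrightarrow> (\<Sum>j\<in>J. C j * L j p) = 0"
    have "(\<forall>s\<in>{1..m}. C (0, s) = 0) \<and> (\<forall>i\<in>{1..n}. C (i, 1) = 0)"
    proof (rule conditions_independent[OF assms])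
      fix a assume "a \<le> 2 * (m + n - 1)"
      then have "homogeneous2 d (iso_monomial d a)" by (intro homogeneous2_iso_monomial) (simp add: d_def)
      then show "(\<Sum>(i, s)\<in>(SIGMA i:{..n}. {1..mult_m1 m i}). C (i, s) *
        eval2 ((dir_deriv (\<beta> i) ^^ (2 * s - 1)) (iso_monomial (2 * (m + n - 1)) a)) (perp (\<beta> i))) = 0"
        using C[of "iso_monomial d a"] by (simp add: J_def L_def split_def d_def)
    qed
    then show "\<forall>j\<in>J. C j = 0" by (auto simp: J_def mult_m1_def split: if_splits)
  qed simp
  moreover have "{p \<in> {p. homogeneous2 d p}. \<forall>j\<in>J. L j p = 0} = hom_quasi_invariants n \<beta> (mult_m1 m) d"
    using quasi_invariant_iff_perp[OF assms(3)]
    by (auto simp: hom_quasi_invariants_def J_def L_def)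
  \<comment> \<open>The independent conditions number \<open>m\<close> for the zeroth vector and one
    for each of the other \<open>n\<close>.\<close>
  ultimately have "d + 1 = dim (hom_quasi_invariants n \<beta> (mult_m1 m) d) + (m + n)"
    by (simp add: dim_homogeneous2 card)
  then show ?thesis using assms(1,2) unfolding d_def by linarith
qed

end
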